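(* Let $\Bbbk$ be a field of characteristic different from $2$ and $n$ a positive integer. Then $$\varphi(e_{(n)})=\begin{cases}\rho_{(n)}&n\text{ even},\\0&n\text{ odd},\end{cases}\qquad \varphi(e_{(0,n)})=\begin{cases}0&n\text{ even},\\2\rho_{(0,n)}&n\text{ odd}.\end{cases}$$ In particular, $\rho_{(n)}$ is idempotent for each even $n$, and $\rho_{(0,n)}$ is idempotent for each odd $n$.
   Context: $B_n$ is the group of signed permutations (bijections $\sigma$ of $\{\pm1,\dots,\pm n\}$ with $\sigma(-i)=-\sigma(i)$); set $\sigma(0)=0$ and $\mathrm{Des}(\sigma)=\{i\in\{0,\dots,n-1\}:\sigma(i)>\sigma(i+1)\}$. $\varphi:\Bbbk B_n\to\Bbbk S_n$ is the linear extension of the map forgetting signs, $\varphi(\sigma)(i)=|\sigma(i)|$. For $\sigma\in S_n$, $\sigma(0)=0$ and $\mathrm{Peak}(\sigma)=\{i\in\{1,\dots,n-1\}:\sigma(i-1)<\sigma(i)>\sigma(i+1)\}$. Define $y_j=\sum\{\sigma\in B_n:\#\mathrm{Des}(\sigma)=j\}$ ($0\le j\le n$), $y^0_j=\sum\{\sigma\in B_n:\#(\mathrm{Des}(\sigma)\setminus\{0\})=j-1\}$ ($1\le j\le n$), $p_j=\sum\{\sigma\in S_n:\#\mathrm{Peak}(\sigma)=j\}$ ($0\le j\le\lfloor n/2\rfloor$), $p^0_j=\sum\{\sigma\in S_n:\#(\mathrm{Peak}(\sigma)\setminus\{1\})=j-1\}$ ($1\le j\le\lfloor(n+1)/2\rfloor$).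 Let $m!!=m(m-2)(m-4)\cdots$ (ending in $2$ or $1$), $0!!=(-1)!!=1$. Define $e_{(n)}=\sum_{j=0}^n(-1)^j\frac{(2j-1)!!(2n-2j-1)!!}{(2n)!!}y_j$, $e_{(0,n)}=\sum_{j=1}^n(-1)^{j-1}\frac{(j-1)!(n-j)!}{n!}y^0_j$, $\rho_{(n)}=\sum_{j=0}^{\lfloor n/2\rfloor}(-1)^j\frac{(2j-1)!!(n-2j-1)!!}{n!!}p_j$, $\rho_{(0,n)}=\sum_{j=1}^{\lfloor(n+1)/2\rfloor}(-1)^{j-1}\frac{(2j-2)!!(n-2j)!!}{n!!}p^0_j$ (rational coefficients interpreted in $\Bbbk$). Products in $\Bbbk S_n$ are the group algebra products.
   Formalization: The claims about φ(e_(0,n)) and about idempotency of ρ_(0,n) are stated only when the rational coefficients of e_(0,n), respectively ρ_(0,n), make sense in the field (reduced denominators nonzero); otherwise, e.g. n = 3 in characteristic 3, these elements are undefined. *)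

theory Defs
  imports
    Complex_Main
    "HOL-Algebra.Sym_Groups"
    "HOL-Library.Poly_Mapping"
begin

section \<open>Group algebras\<close>

text \<open>
  An element of the group algebra of \<open>G\<close> over \<open>'k\<close> is a finitely supported function
  \<open>'g \<Rightarrow>\<^sub>0 'k\<close> whose keys lie in \<open>carrier G\<close>.
\<close>

definition ga_scale :: "'k::field \<Rightarrow> ('g \<Rightarrow>\<^sub>0 'k) \<Rightarrow> ('g \<Rightarrow>\<^sub>0 'k)" where
  "ga_scale c f = Poly_Mapping.map ((*) c) f"

definition ga_mult :: "('g, 'm) monoid_scheme \<Rightarrow> ('g \<Rightarrow>\<^sub>0 'k::field) \<Rightarrow> ('g \<Rightarrow>\<^sub>0 'k) \<Rightarrow> ('g \<Rightarrow>\<^sub>0 'k)" where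
  "ga_mult G f g = (\<Sum>a\<in>Poly_Mapping.keys f. \<Sum>b\<in>Poly_Mapping.keys g.
     Poly_Mapping.single (a \<otimes>\<^bsub>G\<^esub> b) (Poly_Mapping.lookup f a * Poly_Mapping.lookup g b))"

definition ga_idempotent :: "('g, 'm) monoid_scheme \<Rightarrow> ('g \<Rightarrow>\<^sub>0 'k::field) \<Rightarrow> bool" where
  "ga_idempotent G f \<longleftrightarrow> ga_mult G f f = f"

definition ga_lin_ext :: "('g \<Rightarrow> 'h) \<Rightarrow> ('g \<Rightarrow>\<^sub>0 'k::field) \<Rightarrow> ('h \<Rightarrow>\<^sub>0 'k)" where
  "ga_lin_ext h f = (\<Sum>a\<in>Poly_Mapping.keys f. Poly_Mapping.single (h a) (Poly_Mapping.lookup f a))"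

definition ga_sum :: "'g set \<Rightarrow> ('g \<Rightarrow>\<^sub>0 'k::field)" where
  "ga_sum A = (\<Sum>a\<in>A. Poly_Mapping.single a 1)"


section \<open>Signed permutations, descents and peaks\<close>

text \<open>
  A signed permutation is extended by the identity outside \<open>{\<plusminus>1, \<dots>, \<plusminus>n}\<close>, as
  \<^const>\<open>permutes\<close> requires; in particular \<open>\<sigma> 0 = 0\<close>, both here and in \<^const>\<open>sym_group\<close>.
\<close>

definition signed_perms :: "nat \<Rightarrow> (int \<Rightarrow> int) set" where
  "signed_perms n = {\<sigma>. \<sigma> permutes ({- int n..int n} - {0}) \<and> (\<forall>i. \<sigma> (- i) = - \<sigma> i)}"

definition Des :: "nat \<Rightarrow> (int \<Rightarrow> int) \<Rightarrow> nat set" where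
  "Des n \<sigma> = {i \<in> {0..<n}. \<sigma> (int i) > \<sigma> (int i + 1)}"

definition Peak :: "nat \<Rightarrow> (nat \<Rightarrow> nat) \<Rightarrow> nat set" where
  "Peak n \<sigma> = {i \<in> {1..<n}. \<sigma> (i - 1) < \<sigma> i \<and> \<sigma> i > \<sigma> (i + 1)}"

definition forget_signs :: "(int \<Rightarrow> int) \<Rightarrow> nat \<Rightarrow> nat" where
  "forget_signs \<sigma> = (\<lambda>i. nat \<bar>\<sigma> (int i)\<bar>)"

definition phi :: "((int \<Rightarrow> int) \<Rightarrow>\<^sub>0 'k::field) \<Rightarrow> ((nat \<Rightarrow> nat) \<Rightarrow>\<^sub>0 'k)" where
  "phi = ga_lin_ext forget_signs"

definition y_elt :: "nat \<Rightarrow> nat \<Rightarrow> ((int \<Rightarrow> int) \<Rightarrow>\<^sub>0 'k::field)" where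
  "y_elt n j = ga_sum {\<sigma> \<in> signed_perms n. card (Des n \<sigma>) = j}"

definition y0_elt :: "nat \<Rightarrow> nat \<Rightarrow> ((int \<Rightarrow> int) \<Rightarrow>\<^sub>0 'k::field)" where
  "y0_elt n j = ga_sum {\<sigma> \<in> signed_perms n. card (Des n \<sigma> - {0}) = j - 1}"

definition p_elt :: "nat \<Rightarrow> nat \<Rightarrow> ((nat \<Rightarrow> nat) \<Rightarrow>\<^sub>0 'k::field)" where
  "p_elt n j = ga_sum {\<sigma> \<in> carrier (sym_group n). card (Peak n \<sigma>) = j}"

definition p0_elt :: "nat \<Rightarrow> nat \<Rightarrow> ((nat \<Rightarrow> nat) \<Rightarrow>\<^sub>0 'k::field)" where
  "p0_elt n j = ga_sum {\<sigma> \<in> carrier (sym_group n). card (Peak n \<sigma> - {1}) = j - 1}"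


section \<open>Rational coefficients in a field\<close>

text \<open>
  A rational number makes sense in a field of positive characteristic only if its reduced
  denominator is nonzero there; otherwise \<open>rat_to_field\<close> yields the junk value \<open>0\<close>.
\<close>

definition rat_makes_sense :: "'k::field itself \<Rightarrow> rat \<Rightarrow> bool" where
  "rat_makes_sense _ r \<longleftrightarrow> (of_int (snd (quotient_of r)) :: 'k) \<noteq> 0"

definition rat_to_field :: "rat \<Rightarrow> 'k::field" where
  "rat_to_field r = of_int (fst (quotient_of r)) / of_int (snd (quotient_of r))"

text \<open>The argument is an integer because \<open>(-1)!!\<close> is needed.\<close>

function dfact :: "int \<Rightarrow> nat" where
  "dfact m = (if m \<le> 0 then 1 else nat m * dfact (m - 2))"
  by auto
termination by (relation "measure nat") auto

declare dfact.simps [simp del]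

definition e_coeff :: "nat \<Rightarrow> nat \<Rightarrow> rat" where
  "e_coeff n j = (-1) ^ j * of_nat (dfact (2 * int j - 1) * dfact (2 * int n - 2 * int j - 1))
     / of_nat (dfact (2 * int n))"

definition e0_coeff :: "nat \<Rightarrow> nat \<Rightarrow> rat" where
  "e0_coeff n j = (-1) ^ (j - 1) * of_nat (fact (j - 1) * fact (n - j)) / of_nat (fact n)"

definition rho_coeff :: "nat \<Rightarrow> nat \<Rightarrow> rat" where
  "rho_coeff n j = (-1) ^ j * of_nat (dfact (2 * int j - 1) * dfact (int n - 2 * int j - 1))
     / of_nat (dfact (int n))"

definition rho0_coeff :: "nat \<Rightarrow> nat \<Rightarrow> rat" where
  "rho0_coeff n j = (-1) ^ (j - 1) * of_nat (dfact (2 * int j - 2) * dfact (int n - 2 * int j))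
     / of_nat (dfact (int n))"

definition e_elt :: "nat \<Rightarrow> ((int \<Rightarrow> int) \<Rightarrow>\<^sub>0 'k::field)" where
  "e_elt n = (\<Sum>j=0..n. ga_scale (rat_to_field (e_coeff n j)) (y_elt n j))"

definition e0_elt :: "nat \<Rightarrow> ((int \<Rightarrow> int) \<Rightarrow>\<^sub>0 'k::field)" where
  "e0_elt n = (\<Sum>j=1..n. ga_scale (rat_to_field (e0_coeff n j)) (y0_elt n j))"

definition rho_elt :: "nat \<Rightarrow> ((nat \<Rightarrow> nat) \<Rightarrow>\<^sub>0 'k::field)" where
  "rho_elt n = (\<Sum>j=0..n div 2. ga_scale (rat_to_field (rho_coeff n j)) (p_elt n j))"

definition rho0_elt :: "nat \<Rightarrow> ((nat \<Rightarrow> nat) \<Rightarrow>\<^sub>0 'k::field)" where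
  "rho0_elt n = (\<Sum>j=1..(n + 1) div 2. ga_scale (rat_to_field (rho0_coeff n j)) (p0_elt n j))"

text \<open>
  The coefficients of \<open>e_elt n\<close>, and those of \<open>rho_elt n\<close> for even \<open>n\<close>, make sense in every
  field of characteristic other than 2: up to sign they are super Catalan numbers divided by a
  power of 4. Those of \<open>e0_elt n\<close> and \<open>rho0_elt n\<close> need not: for \<open>j = 1\<close> both are \<open>1/n\<close>.
\<close>

lemma dfact_nonpos: "m \<le> 0 \<Longrightarrow> dfact m = 1"
  by (simp add: dfact.simps)

lemma dfact_step: "m > 0 \<Longrightarrow> dfact m = nat m * dfact (m - 2)"
  by (subst dfact.simps) simp

lemma dfact_pos: "dfact m > 0"
  by (induction m rule: dfact.induct) (subst dfact.simps, simp)

lemma dfact_even_fact: "dfact (2 * int m) = 2 ^ m * fact m"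
proof (induction m)
  case (Suc m)
  have "dfact (2 * int (Suc m)) = (2 * m + 2) * dfact (2 * int m)"
    by (subst dfact_step) (simp_all add: algebra_simps nat_add_distrib nat_mult_distrib)
  then show ?case unfolding Suc by (simp add: algebra_simps)
qed (simp add: dfact_nonpos)

lemma dfact_odd_fact: "dfact (2 * int m - 1) * (2 ^ m * fact m) = fact (2 * m)"
proof (induction m)
  case (Suc m)
  have "dfact (2 * int (Suc m) - 1) = (2 * m + 1) * dfact (2 * int m - 1)"
    by (subst dfact_step) (simp_all add: algebra_simps nat_add_distrib nat_mult_distrib)
  then have "dfact (2 * int (Suc m) - 1) * (2 ^ Suc m * fact (Suc m))
      = (2 * m + 1) * (2 * m + 2) * (dfact (2 * int m - 1) * (2 ^ m * fact m))"
    by (simp add: algebra_simps)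
  also have "\<dots> = fact (2 * Suc m)" unfolding Suc by (simp add: algebra_simps)
  finally show ?case .
qed (simp add: dfact_nonpos)

definition e_abs_coeff :: "nat \<Rightarrow> nat \<Rightarrow> rat" where
  "e_abs_coeff j m = of_nat (dfact (2 * int j - 1) * dfact (2 * int m - 1))
     / of_nat (dfact (2 * int (j + m)))"

lemma e_abs_coeff_rec: "e_abs_coeff (Suc j) m = e_abs_coeff j m - e_abs_coeff j (Suc m)"
proof -
  have a: "dfact (2 * int (Suc j) - 1) = (2 * j + 1) * dfact (2 * int j - 1)" for j
    by (subst dfact_step) (simp_all add: algebra_simps nat_add_distrib nat_mult_distrib)
  have b: "dfact (2 * int (Suc k)) = (2 * k + 2) * dfact (2 * int k)" for k
    by (subst dfact_step) (simp_all add: algebra_simps nat_add_distrib nat_mult_distrib)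
  define A B D :: rat where "A = of_nat (dfact (2 * int j - 1))"
    and "B = of_nat (dfact (2 * int m - 1))" and "D = of_nat (dfact (2 * int (j + m)))"
  have D: "D \<noteq> 0" using dfact_pos[of "2 * int (j + m)"] by (simp add: D_def)
  have c: "(2 * of_nat j + 2 * of_nat m + 2 :: rat) \<noteq> 0"
    using of_nat_0_le_iff[of j, where 'a = rat] of_nat_0_le_iff[of m, where 'a = rat] by linarith
  have 1: "e_abs_coeff (Suc j) m = (2 * of_nat j + 1) * A * B / ((2 * of_nat j + 2 * of_nat m + 2) * D)"
    unfolding e_abs_coeff_def A_def B_def D_def add_Suc a b by (simp add: algebra_simps)
  have 2: "e_abs_coeff j (Suc m) = (2 * of_nat m + 1) * A * B / ((2 * of_nat j + 2 * of_nat m + 2) * D)"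
    unfolding e_abs_coeff_def A_def B_def D_def add_Suc_right a b by (simp add: algebra_simps)
  have 3: "e_abs_coeff j m = A * B / D"
    unfolding e_abs_coeff_def A_def B_def D_def by simp
  define N :: rat where "N = 2 * of_nat j + 2 * of_nat m + 2"
  have "A * B / D = N * A * B / (N * D)" using c by (simp add: N_def)
  then have "A * B / D - (2 * of_nat m + 1) * A * B / (N * D)
      = (N * A * B - (2 * of_nat m + 1) * A * B) / (N * D)"
    by (simp only: diff_divide_distrib)
  also have "N * A * B - (2 * of_nat m + 1) * A * B = (2 * of_nat j + 1) * A * B"
    by (simp add: N_def algebra_simps)
  finally show ?thesis unfolding 1 2 3 N_def by simp
qed

lemma e_abs_coeff_dyadic: "\<exists>k. e_abs_coeff j m * 2 ^ k \<in> \<int>"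
proof (induction j arbitrary: m)
  case 0
  have f: "(fact (2 * m) :: rat) = of_nat (2 * m choose m) * (fact m * fact m)"
    using binomial_fact_lemma[of m "2 * m"]
    by (metis (no_types, lifting) add_diff_cancel_left' le_add1 mult.commute mult_2 of_nat_fact of_nat_mult)
  have "(of_nat (dfact (2 * int m - 1)) * (2 ^ m * fact m) :: rat) = fact (2 * m)"
    using dfact_odd_fact[of m] by (metis of_nat_fact of_nat_mult of_nat_numeral of_nat_power)
  then have "(of_nat (dfact (2 * int m - 1)) * 2 ^ m :: rat) = of_nat (2 * m choose m) * fact m"
    unfolding f by simp
  then have "e_abs_coeff 0 m * 2 ^ (m + m) = of_nat (2 * m choose m)"
    using dfact_even_fact[of m]
    by (simp add: e_abs_coeff_def dfact_nonpos power_add field_simps)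
  then show ?case by (metis Ints_of_nat)
next
  case (Suc j)
  obtain k l where k: "e_abs_coeff j m * 2 ^ k \<in> \<int>" and l: "e_abs_coeff j (Suc m) * 2 ^ l \<in> \<int>"
    using Suc by blast
  have "e_abs_coeff (Suc j) m * 2 ^ (k + l)
      = (e_abs_coeff j m * 2 ^ k) * 2 ^ l - (e_abs_coeff j (Suc m) * 2 ^ l) * 2 ^ k"
    by (simp add: e_abs_coeff_rec power_add algebra_simps)
  also have "\<dots> \<in> \<int>" by (rule Ints_diff[OF Ints_mult[OF k] Ints_mult[OF l]]) simp_all
  finally show ?case by blast
qed

lemma rat_makes_sense_dyadic:
  assumes "CHAR('k::field) \<noteq> 2" and "r * 2 ^ k \<in> \<int>"
  shows "rat_makes_sense TYPE('k) r"
proof -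
  obtain a b where q: "quotient_of r = (a, b)" by (cases "quotient_of r")
  have b: "b > 0" "coprime a b" "r = of_int a / of_int b"
    using q quotient_of_denom_pos quotient_of_coprime quotient_of_div by auto
  obtain z where z: "r * 2 ^ k = of_int z" using assms(2) by (auto elim: Ints_cases)
  then have "(of_int (a * 2 ^ k) :: rat) = of_int (z * b)" using b by (simp add: field_simps)
  then have "a * 2 ^ k = z * b" by (simp only: of_int_eq_iff)
  then have "b dvd a * 2 ^ k" by simp
  then have "b dvd 2 ^ k" using b(2) by (simp add: coprime_commute coprime_dvd_mult_right_iff)
  then obtain c where c: "(2::int) ^ k = b * c" by (auto elim: dvdE)
  have two: "(2::'k) \<noteq> 0"
  proof
    assume "(2::'k) = 0"
    then have "of_nat 2 = (0::'k)" by simp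
    then have dvd: "CHAR('k) dvd 2" by (simp only: of_nat_eq_0_iff_char_dvd)
    then have "CHAR('k) \<le> 2" by (rule dvd_imp_le) simp
    moreover have "CHAR('k) \<noteq> 0" using dvd by (metis dvd_0_left_iff zero_neq_numeral)
    moreover have "CHAR('k) \<noteq> 1" by simp
    ultimately show False using assms(1) by linarith
  qed
  have "(2::'k) ^ k = of_int b * of_int c"
    using arg_cong[OF c, of "of_int :: int \<Rightarrow> 'k"] by simp
  then show ?thesis using two by (auto simp: rat_makes_sense_def q)
qed

lemma e_coeff_makes_sense:
  assumes "CHAR('k::field) \<noteq> 2" and "j \<le> n"
  shows "rat_makes_sense TYPE('k) (e_coeff n j)"
proof -
  obtain k where k: "e_abs_coeff j (n - j) * 2 ^ k \<in> \<int>" using e_abs_coeff_dyadic by blast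
  have "e_coeff n j = (-1) ^ j * e_abs_coeff j (n - j)"
    using assms(2) by (simp add: e_coeff_def e_abs_coeff_def of_nat_diff algebra_simps)
  then have "e_coeff n j * 2 ^ k = (-1) ^ j * (e_abs_coeff j (n - j) * 2 ^ k)" by simp
  also have "\<dots> \<in> \<int>" by (rule Ints_mult[OF _ k]) simp
  finally show ?thesis by (rule rat_makes_sense_dyadic[OF assms(1)])
qed

lemma rho_coeff_makes_sense:
  assumes "CHAR('k::field) \<noteq> 2" and "even n" and "j \<le> n div 2"
  shows "rat_makes_sense TYPE('k) (rho_coeff n j)"
proof -
  obtain m where m: "n = 2 * m" using assms(2) by blast
  have "rho_coeff n j = e_coeff m j" by (simp add: m rho_coeff_def e_coeff_def)
  then show ?thesis using e_coeff_makes_sense[OF assms(1), of j m] assms(3) m by simp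
qed

end

theory Submission
  imports Defs "HOL-Computational_Algebra.Polynomial"
begin

text \<open>
  The signed permutations lying over \<open>\<sigma>\<close> correspond to sign patterns, and each position
  contributes to the number of descents independently of the others: a peak always gives one
  descent, a valley none, and any other position one for exactly one of its signs. So the descent
  generating function of the fibre is \<open>(4t)\<^sup>p (1 + t)\<^sup>n\<^sup>-\<^sup>2\<^sup>p\<close> with \<open>p\<close> the number of peaks, and the
  coefficients of \<open>e\<^sub>(\<^sub>n\<^sub>)\<close> and \<open>e\<^sub>(\<^sub>0\<^sub>,\<^sub>n\<^sub>)\<close> are, up to sign, moments of \<open>c\<^sup>j s\<^sup>m\<close> for weights with
  \<open>c + s = 1\<close>; the images follow from \<open>(s - c)\<^sup>2 = 1 - 4 s c\<close>.

  For idempotency, let \<open>X\<^sub>N\<close> be the sum of the permutations sorting the words of length \<open>n\<close> over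
  an alphabet of \<open>N\<close> letters, where ties are broken increasingly for every other letter and
  decreasingly for the rest. Sorting twice is sorting by a lexicographic product, so
  \<open>X\<^sub>N X\<^sub>M = X\<^sub>N\<^sub>M\<close>. The coefficients of \<open>X\<^sub>2\<^sub>k\<^sub>+\<^sub>1\<close> and of \<open>X\<^sub>2\<^sub>k\<close> are polynomials in \<open>k\<close>; the value of the
  former at \<open>k = -1/2\<close> is \<open>\<phi>(e\<^sub>(\<^sub>n\<^sub>))\<close> and the linear term of the latter is \<open>\<phi>(e\<^sub>(\<^sub>0\<^sub>,\<^sub>n\<^sub>))\<close>, and
  comparing coefficients in \<open>X\<^sub>N X\<^sub>M = X\<^sub>N\<^sub>M\<close> gives \<open>e e = e\<close> and \<open>e e = 2 e\<close> respectively. Everything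
  is proved over the rationals and then reduced to the field.
\<close>

section \<open>Sums over sign patterns\<close>

text \<open>If \<open>E j m\<close> is the value of a linear functional at \<open>c\<^sup>j s\<^sup>m\<close>, then \<open>homog E a j m\<close> is its value
  at \<open>(s - c)\<^sup>a c\<^sup>j s\<^sup>m\<close>.\<close>

primrec homog :: "(nat \<Rightarrow> nat \<Rightarrow> rat) \<Rightarrow> nat \<Rightarrow> nat \<Rightarrow> nat \<Rightarrow> rat" where
  "homog E 0 j m = E j m"
| "homog E (Suc a) j m = homog E a j (Suc m) - homog E a (Suc j) m"

text \<open>\<open>S\<close> is the set of negative positions. A negative position counts unless it lies in \<open>B\<close>
  (preceded by a descent of \<open>\<sigma>\<close>), a positive one if it lies in \<open>A\<close> (followed by a descent).\<close>

definition sign_weight :: "nat set \<Rightarrow> nat set \<Rightarrow> nat set \<Rightarrow> nat set \<Rightarrow> nat" where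
  "sign_weight A B U S = card (S - B) + card ((U - S) \<inter> A)"

lemma sign_weight_insert:
  assumes "finite U" "v \<notin> U" "S \<subseteq> U"
  shows "sign_weight A B (insert v U) S = sign_weight A B U S + of_bool (v \<in> A)"
    and "sign_weight A B (insert v U) (insert v S) = sign_weight A B U S + of_bool (v \<notin> B)"
proof -
  have fin: "finite S" using assms finite_subset by blast
  have "(insert v U - S) \<inter> A = (if v \<in> A then insert v ((U - S) \<inter> A) else (U - S) \<inter> A)"
    using assms by auto
  then show "sign_weight A B (insert v U) S = sign_weight A B U S + of_bool (v \<in> A)"
    using assms by (simp add: sign_weight_def)
  have 1: "insert v S - B = (if v \<in> B then S - B else insert v (S - B))" by auto
  have 2: "insert v U - insert v S = U - S" using assms by auto
  have 3: "v \<notin> S" using assms by auto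
  show "sign_weight A B (insert v U) (insert v S) = sign_weight A B U S + of_bool (v \<notin> B)"
    unfolding sign_weight_def 1 2 using fin 3 by simp
qed

lemma sign_weight_le:
  assumes "finite U" "S \<subseteq> U" shows "sign_weight A B U S \<le> card U"
proof -
  have "card (S - B) \<le> card S" "card ((U - S) \<inter> A) \<le> card (U - S)"
    using assms by (auto intro!: card_mono finite_subset[of S U])
  moreover have "card S + card (U - S) = card U"
    using assms by (metis add_diff_inverse_nat card_Diff_subset card_mono finite_subset linorder_not_less)
  ultimately show ?thesis by (simp add: sign_weight_def)
qed

lemma sum_Pow_insert:
  fixes f :: "'a set \<Rightarrow> 'b::comm_monoid_add"
  assumes "finite U" "v \<notin> U"
  shows "(\<Sum>S\<in>Pow (insert v U). f S) = (\<Sum>S\<in>Pow U. f S) + (\<Sum>S\<in>Pow U. f (insert v S))"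
proof -
  have "inj_on (insert v) (Pow U)" using assms by (auto simp: inj_on_def)
  moreover have "Pow U \<inter> insert v ` Pow U = {}" using assms by auto
  ultimately show ?thesis
    using assms by (simp add: Pow_insert sum.union_disjoint sum.reindex)
qed

text \<open>The sum factors over the positions. With \<open>c\<close> and \<open>s\<close> as for
  \<open>homog\<close>, a position in \<open>A - B\<close> counts for either sign and gives
  \<open>- 2 c\<close>, one in \<open>B - A\<close> never counts and gives \<open>2 s\<close>, and
  any other counts for exactly one sign and gives \<open>s - c\<close>. The offsets \<open>j\<close>
  and \<open>m\<close> stay arbitrary so that the factors of a new position can be absorbed into
  them.\<close>

lemma sum_sign_weight:
  assumes "finite U"
  shows "(\<Sum>S\<in>Pow U. (-1) ^ sign_weight A B U S *
            E (j + sign_weight A B U S) (m + card U - sign_weight A B U S))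
       = (-2) ^ card (U \<inter> A - B) * 2 ^ card (U \<inter> B - A) *
         homog E (card U - card (U \<inter> A - B) - card (U \<inter> B - A))
           (j + card (U \<inter> A - B)) (m + card (U \<inter> B - A))"
  using assms
proof (induction U arbitrary: j m rule: finite_induct)
  case empty
  then show ?case by (simp add: sign_weight_def)
next
  case (insert v U)
  define p q w where "p = card (U \<inter> A - B)" and "q = card (U \<inter> B - A)"
    and "w = sign_weight A B U"
  define T where "T = (\<lambda>j m. \<Sum>S\<in>Pow U. (-1) ^ w S * E (j + w S) (m + card U - w S))"
  have T: "T j m = (-2) ^ p * 2 ^ q * homog E (card U - p - q) (j + p) (m + q)" for j m
    unfolding T_def p_def q_def w_def by (rule insert.IH)
  have pq: "p + q \<le> card U"
  proof -
    have "p + q = card ((U \<inter> A - B) \<union> (U \<inter> B - A))"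
      unfolding p_def q_def using insert.hyps by (subst card_Un_disjoint) auto
    also have "\<dots> \<le> card U" using insert.hyps by (intro card_mono) auto
    finally show ?thesis .
  qed
  have wle: "w S \<le> card U" if "S \<in> Pow U" for S
    using that sign_weight_le[OF insert.hyps(1)] by (simp add: w_def)
  \<comment> \<open>A new position that does not count multiplies by \<open>s\<close>, which raises
    \<open>m\<close>; one that counts multiplies by \<open>- c\<close>, which raises
    \<open>j\<close>. The bound \<open>wle\<close> keeps the truncated subtraction exact.\<close>
  have eq1: "(\<Sum>S\<in>Pow U. (-1) ^ (w S + e) * E (j + (w S + e)) (m + Suc (card U) - (w S + e)))
      = (if e = 0 then T j (Suc m) else - T (Suc j) m)" if "e \<in> {0, 1}" for e
    using that wle unfolding T_def by (auto simp: sum_negf[symmetric] Suc_diff_le intro!: sum.cong)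
  have w1: "sign_weight A B (insert v U) S = w S + of_bool (v \<in> A)"
    and w2: "sign_weight A B (insert v U) (insert v S) = w S + of_bool (v \<notin> B)"
    if "S \<in> Pow U" for S
    using that sign_weight_insert[OF insert.hyps, of S] by (simp_all add: w_def)
  have "(\<Sum>S\<in>Pow (insert v U). (-1) ^ sign_weight A B (insert v U) S *
            E (j + sign_weight A B (insert v U) S) (m + card (insert v U) - sign_weight A B (insert v U) S))
     = (\<Sum>S\<in>Pow U. (-1) ^ (w S + of_bool (v \<in> A)) *
            E (j + (w S + of_bool (v \<in> A))) (m + Suc (card U) - (w S + of_bool (v \<in> A))))
     + (\<Sum>S\<in>Pow U. (-1) ^ (w S + of_bool (v \<notin> B)) *
            E (j + (w S + of_bool (v \<notin> B))) (m + Suc (card U) - (w S + of_bool (v \<notin> B))))"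
    unfolding sum_Pow_insert[OF insert.hyps] card_insert_disjoint[OF insert.hyps]
    by (intro arg_cong2[where f = "(+)"] sum.cong refl) (simp_all only: w1 w2)
  also have "\<dots> = (if v \<in> A then - T (Suc j) m else T j (Suc m))
      + (if v \<in> B then T j (Suc m) else - T (Suc j) m)"
    by (subst (1 2) eq1) auto
  also have "\<dots> = (-2) ^ card (insert v U \<inter> A - B) * 2 ^ card (insert v U \<inter> B - A) *
         homog E (card (insert v U) - card (insert v U \<inter> A - B) - card (insert v U \<inter> B - A))
           (j + card (insert v U \<inter> A - B)) (m + card (insert v U \<inter> B - A))"
  proof -
    have a: "card (insert v U \<inter> A - B) = (if v \<in> A - B then Suc p else p)"
    proof -
      have "insert v U \<inter> A - B = (if v \<in> A - B then insert v (U \<inter> A - B) else U \<inter> A - B)" by auto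
      then show ?thesis using insert.hyps by (simp add: p_def)
    qed
    have b: "card (insert v U \<inter> B - A) = (if v \<in> B - A then Suc q else q)"
    proof -
      have "insert v U \<inter> B - A = (if v \<in> B - A then insert v (U \<inter> B - A) else U \<inter> B - A)" by auto
      then show ?thesis using insert.hyps by (simp add: q_def)
    qed
    have c: "card (insert v U) = Suc (card U)" using insert.hyps by simp
    have d: "Suc (card U) - p - q = Suc (card U - p - q)" using pq by simp
    show ?thesis unfolding a b c T using d
      by (cases "v \<in> A"; cases "v \<in> B") (auto simp: algebra_simps)
  qed
  finally show ?case .
qed

text \<open>Exchanging \<open>c\<close> and \<open>s\<close> negates \<open>s - c\<close>.\<close>

lemma homog_swap:
  assumes "\<And>j m. E j m = E m j"
  shows "homog E a j m = (-1) ^ a * homog E a m j"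
proof (induction a arbitrary: j m)
  case (Suc a)
  show ?case by (simp add: Suc[of j "Suc m"] Suc[of "Suc j" m] algebra_simps)
qed (simp add: assms)

text \<open>The relation \<open>c + s = 1\<close> survives multiplication by
  \<open>(s - c)^a\<close>.\<close>

lemma homog_rec:
  assumes "\<And>j m. E j m = E (Suc j) m + E j (Suc m)"
  shows "homog E a j m = homog E a (Suc j) m + homog E a j (Suc m)"
proof (induction a arbitrary: j m)
  case 0
  show ?case using assms[of j m] by simp
next
  case (Suc a)
  show ?case using Suc[of j "Suc m"] Suc[of "Suc j" m] by simp
qed

text \<open>With weights \<open>c, s\<close> of total 1 this is \<open>(s - c)\<^sup>2 = (s + c)\<^sup>2 - 4 s c\<close>.\<close>

lemma homog_even_eq:
  assumes E: "\<And>j m. E j m = E (Suc j) m + E j (Suc m)"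
    and R: "\<And>j m. R j m = R (Suc j) m + R j (Suc m)"
    and base: "\<And>b. 4 ^ b * E b b = R b 0"
  shows "4 ^ b * homog E (2 * a) b b = R b a"
proof (induction a arbitrary: b)
  case (Suc a)
  note h = homog_rec[of E, OF E]
  \<comment> \<open>Here \<open>R b a\<close> stands for the moment of \<open>u^b (1 - u)^a\<close>
    with \<open>u = 4 s c\<close>. The uses of \<open>h\<close> turn
    \<open>s^2 - 2 s c + c^2\<close> into \<open>1 - 4 s c\<close>, and the recursion of
    \<open>R\<close> is \<open>1 - (1 - u) = u\<close>.\<close>
  have "homog E (2 * Suc a) b b = homog E (2 * a) b b - 4 * homog E (2 * a) (Suc b) (Suc b)"
    using h[of "2 * a" b b] h[of "2 * a" "Suc b" b] h[of "2 * a" b "Suc b"] by simp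
  then have "4 ^ b * homog E (2 * Suc a) b b
      = 4 ^ b * homog E (2 * a) b b - 4 ^ Suc b * homog E (2 * a) (Suc b) (Suc b)"
    by (simp only: power_Suc right_diff_distrib mult_ac)
  then show ?case using R[of b a] unfolding Suc by simp
qed (simp add: base)

lemma homog_odd_eq_0:
  assumes "\<And>j m. E j m = E m j" "odd a"
  shows "homog E a b b = 0"
  using homog_swap[of E a b b, OF assms(1)] assms(2) by simp

section \<open>The coefficients\<close>

lemma dfact_odd_Suc: "dfact (2 * int (Suc j) - 1) = (2 * j + 1) * dfact (2 * int j - 1)"
  by (subst dfact_step) (simp_all add: algebra_simps nat_add_distrib nat_mult_distrib)

lemma e_abs_coeff_pascal: "e_abs_coeff j m = e_abs_coeff (Suc j) m + e_abs_coeff j (Suc m)"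
  by (simp add: e_abs_coeff_rec)

lemma e_abs_coeff_swap: "e_abs_coeff j m = e_abs_coeff m j"
  by (simp add: e_abs_coeff_def add.commute mult.commute)

lemma e_coeff_eq: "j \<le> n \<Longrightarrow> e_coeff n j = (-1) ^ j * e_abs_coeff j (n - j)"
  by (simp add: e_coeff_def e_abs_coeff_def of_nat_diff algebra_simps)

text \<open>The numbers \<open>e_abs_coeff j m\<close> are the moments of
  \<open>c^j (1 - c)^m\<close> for the arcsine law on [0, 1]. That law is preserved by the map from
  \<open>c\<close> to \<open>4 c (1 - c)\<close>, which is why the same numbers reappear as the
  \<open>R\<close> of \<open>homog_even_eq\<close>.\<close>

lemma rho_coeff_eq: "rho_coeff (2 * (b + a)) b = (-1) ^ b * e_abs_coeff b a"
  by (simp add: rho_coeff_def e_abs_coeff_def algebra_simps)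

text \<open>From \<open>(4b)!! = 4^b (2b)!\<close> and
  \<open>(2b)! = (2b - 1)!! (2b)!!\<close>.\<close>

lemma e_abs_coeff_diag: "4 ^ b * e_abs_coeff b b = e_abs_coeff b 0"
proof -
  have "dfact (2 * int (b + b)) = 2 ^ (2 * b) * fact (2 * b)"
    by (simp only: dfact_even_fact mult_2[of b, symmetric])
  also have "\<dots> = 4 ^ b * (dfact (2 * int b - 1) * (2 ^ b * fact b))"
    by (simp add: dfact_odd_fact power_mult)
  also have "\<dots> = 4 ^ b * (dfact (2 * int b - 1) * dfact (2 * int b))"
    by (simp add: dfact_even_fact)
  finally show ?thesis
    using dfact_pos[of "2 * int b - 1"] dfact_pos[of "2 * int b"]
    by (simp add: e_abs_coeff_def dfact_nonpos field_simps)
qed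

text \<open>The Beta integral of \<open>c^j (1 - c)^m\<close> over [0, 1]: the moments of the
  uniform law.\<close>

definition e0_abs_coeff :: "nat \<Rightarrow> nat \<Rightarrow> rat" where
  "e0_abs_coeff j m = fact j * fact m / fact (Suc (j + m))"

text \<open>The moment of \<open>u^b (1 - u)^a\<close> for \<open>u = 4 c (1 - c)\<close> with
  \<open>c\<close> uniform on [0, 1].\<close>

definition rho0_abs_coeff :: "nat \<Rightarrow> nat \<Rightarrow> rat" where
  "rho0_abs_coeff b a = of_nat (dfact (2 * int b) * dfact (2 * int a - 1))
     / of_nat (dfact (2 * int (Suc (b + a)) - 1))"

lemma e0_abs_coeff_pascal: "e0_abs_coeff j m = e0_abs_coeff (Suc j) m + e0_abs_coeff j (Suc m)"
proof -
  define N F :: rat where "N = of_nat (Suc (Suc (j + m)))" and "F = fact (Suc (j + m))"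
  have nz: "N \<noteq> 0" "F \<noteq> 0" by (simp_all add: N_def F_def del: of_nat_Suc)
  have f: "(fact (Suc (Suc (j + m))) :: rat) = N * F"
    by (simp only: N_def F_def fact_Suc[of "Suc (j + m)"])
  have "e0_abs_coeff (Suc j) m + e0_abs_coeff j (Suc m)
      = (of_nat (Suc j) * (fact j * fact m) + of_nat (Suc m) * (fact j * fact m)) / (N * F)"
    unfolding e0_abs_coeff_def add_Suc add_Suc_right f add_divide_distrib
    by (simp only: fact_Suc mult_ac)
  also have "\<dots> = N * (fact j * fact m) / (N * F)"
    by (simp add: N_def algebra_simps)
  finally show ?thesis using nz by (simp add: e0_abs_coeff_def F_def)
qed

lemma e0_abs_coeff_swap: "e0_abs_coeff j m = e0_abs_coeff m j"
  by (simp add: e0_abs_coeff_def add.commute mult.commute)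

lemma e0_coeff_eq: "1 \<le> j \<Longrightarrow> j \<le> n \<Longrightarrow> e0_coeff n j = (-1) ^ (j - 1) * e0_abs_coeff (j - 1) (n - j)"
  by (simp add: e0_coeff_def e0_abs_coeff_def)

lemma rho0_coeff_eq: "rho0_coeff (2 * (b + a) + 1) (Suc b) = (-1) ^ b * rho0_abs_coeff b a"
  by (simp add: rho0_coeff_def rho0_abs_coeff_def algebra_simps)

lemma rho0_abs_coeff_pascal:
  "rho0_abs_coeff b a = rho0_abs_coeff (Suc b) a + rho0_abs_coeff b (Suc a)"
proof -
  have 1: "dfact (2 * int (Suc b)) = (2 * b + 2) * dfact (2 * int b)"
    by (subst dfact_step) (simp_all add: algebra_simps nat_add_distrib nat_mult_distrib)
  have 2: "dfact (2 * int (Suc (Suc (b + a))) - 1)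
      = (2 * b + 2 * a + 3) * dfact (2 * int (Suc (b + a)) - 1)"
    using dfact_odd_Suc[of "Suc (b + a)"] by (simp add: algebra_simps)
  define A B D :: rat where "A = of_nat (dfact (2 * int b))"
    and "B = of_nat (dfact (2 * int a - 1))" and "D = of_nat (dfact (2 * int (Suc (b + a)) - 1))"
  have D: "D \<noteq> 0" using dfact_pos[of "2 * int (Suc (b + a)) - 1"] by (simp add: D_def)
  define N :: rat where "N = 2 * of_nat b + 2 * of_nat a + 3"
  have N: "N \<noteq> 0" unfolding N_def using of_nat_0_le_iff[of a, where 'a = rat]
      of_nat_0_le_iff[of b, where 'a = rat] by linarith
  have "rho0_abs_coeff (Suc b) a = (2 * of_nat b + 2) * A * B / (N * D)"
    unfolding rho0_abs_coeff_def 1 2 add_Suc A_def B_def D_def N_def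
    by (simp only: of_nat_mult of_nat_add of_nat_numeral of_nat_1 mult_ac)
  moreover have "rho0_abs_coeff b (Suc a) = (2 * of_nat a + 1) * A * B / (N * D)"
    unfolding rho0_abs_coeff_def dfact_odd_Suc[of a] 2 add_Suc_right A_def B_def D_def N_def
    by (simp only: of_nat_mult of_nat_add of_nat_numeral of_nat_1 mult_ac)
  moreover have "(2 * of_nat b + 2) * A * B / (N * D) + (2 * of_nat a + 1) * A * B / (N * D)
      = N * (A * B) / (N * D)"
    by (simp add: N_def add_divide_distrib[symmetric] algebra_simps)
  moreover have "rho0_abs_coeff b a = A * B / D"
    unfolding rho0_abs_coeff_def by (simp add: A_def B_def D_def)
  ultimately show ?thesis using N by simp
qed

text \<open>From \<open>(2b + 1)! = (2b + 1)!! (2b)!!\<close> and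
  \<open>(2b)!! = 2^b b!\<close>.\<close>

lemma e0_abs_coeff_diag: "4 ^ b * e0_abs_coeff b b = rho0_abs_coeff b 0"
proof -
  have "dfact (2 * int (Suc b) - 1) * (2 ^ b * fact b) = fact (Suc (2 * b))"
    unfolding dfact_odd_Suc mult.assoc dfact_odd_fact by simp
  then have "of_nat (dfact (2 * int (Suc b) - 1) * (2 ^ b * fact b)) = (of_nat (fact (Suc (2 * b))) :: rat)"
    by (rule arg_cong)
  then have "of_nat (dfact (2 * int (Suc b) - 1)) * (2 ^ b * fact b) = (fact (Suc (b + b)) :: rat)"
    by (simp only: of_nat_mult of_nat_power of_nat_numeral of_nat_fact mult_2[of b])
  note f = this[symmetric]
  have "(4::rat) ^ b = 2 ^ b * 2 ^ b" using power_mult_distrib[of 2 "2::rat" b] by simp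
  then show ?thesis
    using dfact_pos[of "2 * int (Suc b) - 1"]
    by (simp add: e0_abs_coeff_def rho0_abs_coeff_def dfact_even_fact dfact_nonpos f
          del: fact_Suc of_nat_Suc)
qed

section \<open>Signed lifts of a permutation\<close>

definition desc :: "nat \<Rightarrow> (nat \<Rightarrow> nat) \<Rightarrow> nat set" where
  "desc n \<sigma> = {i \<in> {1..<n}. \<sigma> (Suc i) < \<sigma> i}"

text \<open>The descents of the lift of \<sigma> that is negative exactly at the positions in
  \<open>S\<close>. Of two neighbouring entries the one with larger absolute value decides: at a
  descent of \<sigma> this is entry \<open>i\<close>, which has to be positive; otherwise it is
  entry \<open>i + 1\<close>, which has to be negative. Position 0 falls under the second
  case.\<close>

definition lift_des :: "nat \<Rightarrow> (nat \<Rightarrow> nat) \<Rightarrow> nat set \<Rightarrow> nat set" where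
  "lift_des n \<sigma> S = {i. i < n \<and> (if i \<in> desc n \<sigma> then i \<notin> S else Suc i \<in> S)}"

definition signed_lift :: "(nat \<Rightarrow> nat) \<Rightarrow> nat set \<Rightarrow> int \<Rightarrow> int" where
  "signed_lift \<sigma> S x = (if nat \<bar>x\<bar> \<in> S then - (sgn x * int (\<sigma> (nat \<bar>x\<bar>))) else sgn x * int (\<sigma> (nat \<bar>x\<bar>)))"

lemma permutes_interval_0: "\<sigma> permutes {1..n::nat} \<Longrightarrow> \<sigma> 0 = 0"
  by (simp add: permutes_not_in)

lemma permutes_interval_range: "\<sigma> permutes {1..n::nat} \<Longrightarrow> 1 \<le> \<sigma> i \<and> \<sigma> i \<le> n \<longleftrightarrow> 1 \<le> i \<and> i \<le> n"
  using permutes_in_image[of \<sigma> "{1..n}" i] by simp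

lemma permutes_interval_pos: "\<sigma> permutes {1..n::nat} \<Longrightarrow> 0 < \<sigma> i \<longleftrightarrow> 0 < i"
  using permutes_inj[of \<sigma> "{1..n}"] permutes_interval_0[of \<sigma> n] by (metis injD neq0_conv)

lemma not_desc_iff:
  assumes "\<sigma> permutes {1..n}" "i < n"
  shows "i \<notin> desc n \<sigma> \<longleftrightarrow> \<sigma> i < \<sigma> (Suc i)"
proof -
  have "\<sigma> i \<noteq> \<sigma> (Suc i)" using permutes_inj[OF assms(1)] by (metis injD n_not_Suc_n)
  moreover have "\<sigma> 0 < \<sigma> (Suc 0)"
    using permutes_interval_pos[OF assms(1)] permutes_interval_0[OF assms(1)] by simp
  ultimately show ?thesis using assms(2) by (cases "i = 0") (auto simp: desc_def)
qed

text \<open>No descent at \<open>i - 1\<close> means an ascent there, also for \<open>i = 1\<close>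
  because \<sigma> fixes 0.\<close>

lemma Peak_eq:
  assumes "\<sigma> permutes {1..n}"
  shows "Peak n \<sigma> = desc n \<sigma> - Suc ` desc n \<sigma>"
proof -
  have "i \<in> Peak n \<sigma> \<longleftrightarrow> i \<in> desc n \<sigma> - Suc ` desc n \<sigma>" for i
  proof (cases i)
    case (Suc k)
    show ?thesis
    proof (cases "i < n")
      case True
      then have "k \<notin> desc n \<sigma> \<longleftrightarrow> \<sigma> k < \<sigma> (Suc k)" using not_desc_iff[OF assms, of k] Suc by simp
      then show ?thesis using True Suc by (auto simp: Peak_def desc_def)
    qed (auto simp: Peak_def desc_def)
  qed (auto simp: Peak_def desc_def)
  then show ?thesis by blast
qed

text \<open>A descent of the lift at a descent \<open>i\<close> of \<sigma> is charged to the
  positive position \<open>i\<close>, any other one to the negative position \<open>i + 1\<close>.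
  Discarding the descent 0 amounts to never counting position 1 when it is negative.\<close>

lemma card_lift_des:
  assumes "S \<subseteq> {1..n}"
  shows "card (lift_des n \<sigma> S) = sign_weight (desc n \<sigma>) (Suc ` desc n \<sigma>) {1..n} S"
    and "card (lift_des n \<sigma> S - {0}) = sign_weight (desc n \<sigma>) (insert 1 (Suc ` desc n \<sigma>)) {1..n} S"
proof -
  define A where "A = desc n \<sigma>"
  have A: "A \<subseteq> {1..<n}" by (auto simp: A_def desc_def)
  define X where "X = {i. i < n \<and> i \<notin> A \<and> Suc i \<in> S}"
  have X: "finite X" by (rule finite_subset[of _ "{..<n}"]) (auto simp: X_def)
  define Y where "Y = ({1..n} - S) \<inter> A"
  have Y: "finite Y" "0 \<notin> Y" by (auto simp: Y_def)
  have L: "lift_des n \<sigma> S = X \<union> Y" "X \<inter> Y = {}"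
    using A by (auto simp: lift_des_def X_def Y_def A_def[symmetric])
  have SX: "Suc ` X = S - Suc ` A"
  proof
    show "S - Suc ` A \<subseteq> Suc ` X"
    proof
      fix s assume s: "s \<in> S - Suc ` A"
      then obtain i where "s = Suc i" using assms by (cases s) auto
      then show "s \<in> Suc ` X" using s assms by (intro image_eqI[of _ _ i]) (auto simp: X_def)
    qed
  qed (auto simp: X_def)
  have "card X = card (Suc ` X)" by (simp add: card_image)
  then show "card (lift_des n \<sigma> S) = sign_weight (desc n \<sigma>) (Suc ` desc n \<sigma>) {1..n} S"
    unfolding sign_weight_def A_def[symmetric] using L X Y
    by (simp add: card_Un_disjoint SX) (simp add: Y_def)
  have "Suc ` (X - {0}) = S - insert 1 (Suc ` A)"
    using SX by (auto simp: image_set_diff)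
  then have "card (X - {0}) = card (S - insert 1 (Suc ` A))"
    by (metis card_image inj_Suc inj_on_subset subset_UNIV)
  moreover have "lift_des n \<sigma> S - {0} = (X - {0}) \<union> Y" using L(1) Y(2) by auto
  moreover have "(X - {0}) \<inter> Y = {}" using L by auto
  ultimately show "card (lift_des n \<sigma> S - {0}) = sign_weight (desc n \<sigma>) (insert 1 (Suc ` desc n \<sigma>)) {1..n} S"
    unfolding sign_weight_def A_def[symmetric] using X Y
    by (simp add: card_Un_disjoint) (simp add: Y_def)
qed

lemma card_lift_des_le: "card (lift_des n \<sigma> S) \<le> n"
proof -
  have "card (lift_des n \<sigma> S) \<le> card {..<n}" by (rule card_mono) (auto simp: lift_des_def)
  then show ?thesis by simp
qed

lemma card_lift_des_minus_less: "0 < n \<Longrightarrow> card (lift_des n \<sigma> S - {0}) < n"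
proof -
  assume "0 < n"
  have "card (lift_des n \<sigma> S - {0}) \<le> card {1..<n}" by (rule card_mono) (auto simp: lift_des_def)
  then show ?thesis using \<open>0 < n\<close> by simp
qed

text \<open>The shift preserves cardinality, so there are as many valleys (\<open>B - A\<close>) as
  peaks (\<open>A - B\<close>). Treating position 1 as preceded by a descent gives one valley
  more.\<close>

lemma card_desc_diff:
  shows "card (Suc ` desc n \<sigma> - desc n \<sigma>) = card (desc n \<sigma> - Suc ` desc n \<sigma>)"
    and "card (insert 1 (Suc ` desc n \<sigma>) - desc n \<sigma>) = Suc (card (desc n \<sigma> - insert 1 (Suc ` desc n \<sigma>)))"
proof -
  have *: "card (B - A) + card A = card (A - B) + card B" if "finite A" "finite B" for A B :: "nat set"
    using card_Int_Diff[OF that(1), of B] card_Int_Diff[OF that(2), of A]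
    by (simp add: Int_commute)
  have fin: "finite (desc n \<sigma>)" by (simp add: desc_def)
  have c: "card (Suc ` desc n \<sigma>) = card (desc n \<sigma>)" by (simp add: card_image)
  show "card (Suc ` desc n \<sigma> - desc n \<sigma>) = card (desc n \<sigma> - Suc ` desc n \<sigma>)"
    using *[OF fin, of "Suc ` desc n \<sigma>"] fin c by simp
  have "1 \<notin> Suc ` desc n \<sigma>" by (auto simp: desc_def)
  then have "card (insert 1 (Suc ` desc n \<sigma>)) = Suc (card (desc n \<sigma>))" using fin c by simp
  then show "card (insert 1 (Suc ` desc n \<sigma>) - desc n \<sigma>) = Suc (card (desc n \<sigma> - insert 1 (Suc ` desc n \<sigma>)))"
    using *[OF fin, of "insert 1 (Suc ` desc n \<sigma>)"] fin by simp
qed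

lemma desc_subset: "desc n \<sigma> \<subseteq> {1..n}" "Suc ` desc n \<sigma> \<subseteq> {1..n}"
  by (auto simp: desc_def)

lemma card_two_diffs_le:
  assumes "finite U" "A \<subseteq> U" "B \<subseteq> U" shows "card (A - B) + card (B - A) \<le> card U"
proof -
  have "card (A - B) + card (B - A) = card ((A - B) \<union> (B - A))"
    using assms by (subst card_Un_disjoint) (auto intro: finite_subset)
  also have "\<dots> \<le> card U" using assms by (intro card_mono) auto
  finally show ?thesis .
qed

text \<open>Peaks and the equally many valleys are disjoint sets of positions.\<close>

lemma card_Peak_le:
  assumes "\<sigma> permutes {1..n}" shows "2 * card (Peak n \<sigma>) \<le> n"
  using card_two_diffs_le[OF _ desc_subset[of n \<sigma>]]
  by (simp add: Peak_eq[OF assms] card_desc_diff)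

lemma Peak_minus_eq:
  assumes "\<sigma> permutes {1..n}"
  shows "Peak n \<sigma> - {1} = desc n \<sigma> - insert 1 (Suc ` desc n \<sigma>)"
  using Peak_eq[OF assms] by auto

lemma card_Peak_minus_le:
  assumes "\<sigma> permutes {1..n}" "0 < n" shows "2 * card (Peak n \<sigma> - {1}) + 1 \<le> n"
proof -
  have "insert 1 (Suc ` desc n \<sigma>) \<subseteq> {1..n}" using desc_subset[of n \<sigma>] assms(2) by auto
  from card_two_diffs_le[OF _ desc_subset(1)[of n \<sigma>] this] show ?thesis
    unfolding card_desc_diff Peak_minus_eq[OF assms(1)] by simp
qed

section \<open>Summing the coefficients over all lifts of a permutation\<close>

lemma neg2_power: "(- 2) ^ p * 2 ^ p = (- 1) ^ p * (4::rat) ^ p"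
  using power_mult_distrib[of "- 2::rat" 2 p] power_mult_distrib[of "- 1::rat" 4 p] by simp

text \<open>The \<open>p\<close> peaks and \<open>p\<close> valleys contribute
  \<open>(- 4 c s)^p\<close>, the other positions \<open>(s - c)^(n - 2p)\<close>. For odd
  \<open>n\<close> the exponent is odd and the moment vanishes by symmetry; for even
  \<open>n\<close> it is evaluated by \<open>homog_even_eq\<close>.\<close>

lemma sum_e_coeff:
  assumes "\<sigma> permutes {1..n}"
  shows "(\<Sum>S\<in>Pow {1..n}. e_coeff n (card (lift_des n \<sigma> S)))
    = (if even n then rho_coeff n (card (Peak n \<sigma>)) else 0)"
proof -
  define A B p where "A = desc n \<sigma>" and "B = Suc ` desc n \<sigma>" and "p = card (Peak n \<sigma>)"
  have U: "{1..n} \<inter> A = A" "{1..n} \<inter> B = B" using desc_subset[of n \<sigma>] by (auto simp: A_def B_def)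
  have p: "card (A - B) = p" "card (B - A) = p"
    using card_desc_diff[of n \<sigma>] by (simp_all add: p_def A_def B_def Peak_eq[OF assms])
  have le: "2 * p \<le> n" using card_Peak_le[OF assms] by (simp add: p_def)
  have "(\<Sum>S\<in>Pow {1..n}. e_coeff n (card (lift_des n \<sigma> S)))
      = (\<Sum>S\<in>Pow {1..n}. (-1) ^ sign_weight A B {1..n} S *
            e_abs_coeff (0 + sign_weight A B {1..n} S) (0 + card {1..n} - sign_weight A B {1..n} S))"
  proof (intro sum.cong refl)
    fix S assume "S \<in> Pow {1..n}"
    then have "card (lift_des n \<sigma> S) = sign_weight A B {1..n} S"
      by (simp add: card_lift_des A_def B_def)
    then show "e_coeff n (card (lift_des n \<sigma> S)) = (-1) ^ sign_weight A B {1..n} S *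
            e_abs_coeff (0 + sign_weight A B {1..n} S) (0 + card {1..n} - sign_weight A B {1..n} S)"
      using card_lift_des_le[of n \<sigma> S] by (simp add: e_coeff_eq)
  qed
  also have "\<dots> = (-1) ^ p * (4 ^ p * homog e_abs_coeff (n - 2 * p) p p)"
    by (simp only: sum_sign_weight[OF finite_atLeastAtMost] U p) (simp add: neg2_power mult_2 flip: mult.assoc)
  also have "\<dots> = (if even n then rho_coeff n p else 0)"
  proof (cases "even n")
    case True
    then obtain m where m: "n = 2 * m" by blast
    then obtain a where "m = p + a" using le le_Suc_ex by auto
    then have n: "n = 2 * (p + a)" using m by simp
    have "4 ^ p * homog e_abs_coeff (2 * a) p p = e_abs_coeff p a"
      by (rule homog_even_eq[OF e_abs_coeff_pascal e_abs_coeff_pascal e_abs_coeff_diag])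
    then show ?thesis using True n rho_coeff_eq[of p a] by simp
  next
    case False
    then have "homog e_abs_coeff (n - 2 * p) p p = 0"
      using le by (intro homog_odd_eq_0 e_abs_coeff_swap) simp
    then show ?thesis using False by simp
  qed
  finally show ?thesis by (simp add: p_def)
qed

lemma homog_shift: "homog (\<lambda>j m. E j (m - 1)) a j (Suc m) = homog E a j m"
  by (induction a arbitrary: j m) simp_all

text \<open>As for \<open>sum_e_coeff\<close>, but with one valley more than peaks. Its factor
  \<open>2 s\<close> supplies the 2 in the result and leaves \<open>n - 1 - 2p\<close> other
  positions, so the parities change roles.\<close>

lemma sum_e0_coeff:
  assumes "\<sigma> permutes {1..n}" "0 < n"
  shows "(\<Sum>S\<in>Pow {1..n}. e0_coeff n (Suc (card (lift_des n \<sigma> S - {0}))))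
    = (if even n then 0 else 2 * rho0_coeff n (Suc (card (Peak n \<sigma> - {1}))))"
proof -
  define A B p where "A = desc n \<sigma>" and "B = insert 1 (Suc ` desc n \<sigma>)" and "p = card (Peak n \<sigma> - {1})"
  have U: "{1..n} \<inter> A = A" "{1..n} \<inter> B = B"
    using desc_subset[of n \<sigma>] assms(2) by (auto simp: A_def B_def)
  have p: "card (A - B) = p" "card (B - A) = Suc p"
    using card_desc_diff(2)[of n \<sigma>] unfolding p_def A_def B_def Peak_minus_eq[OF assms(1)] by simp_all
  have le: "2 * p + 1 \<le> n" using card_Peak_minus_le[OF assms] by (simp add: p_def)
  \<comment> \<open>The exponents in \<open>e0_coeff\<close> add up to \<open>n - 1\<close>, those
    in \<open>sum_sign_weight\<close> to \<open>n\<close>, so one factor \<open>s\<close> is divided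
    out. The truncated value at \<open>m = 0\<close> never occurs: fewer than \<open>n\<close>
    positions count, and the extra valley makes the second index \<open>Suc p\<close>.\<close>
  define E where "E = (\<lambda>j m. e0_abs_coeff j (m - 1))"
  have "(\<Sum>S\<in>Pow {1..n}. e0_coeff n (Suc (card (lift_des n \<sigma> S - {0}))))
      = (\<Sum>S\<in>Pow {1..n}. (-1) ^ sign_weight A B {1..n} S *
            E (0 + sign_weight A B {1..n} S) (0 + card {1..n} - sign_weight A B {1..n} S))"
  proof (intro sum.cong refl)
    fix S assume "S \<in> Pow {1..n}"
    then have *: "card (lift_des n \<sigma> S - {0}) = sign_weight A B {1..n} S"
      by (simp add: card_lift_des A_def B_def)
    have "Suc (card (lift_des n \<sigma> S - {0})) \<le> n"
      using card_lift_des_minus_less[OF assms(2), of \<sigma> S] by simp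
    from e0_coeff_eq[OF _ this] show "e0_coeff n (Suc (card (lift_des n \<sigma> S - {0}))) = (-1) ^ sign_weight A B {1..n} S *
            E (0 + sign_weight A B {1..n} S) (0 + card {1..n} - sign_weight A B {1..n} S)"
      unfolding * E_def by simp
  qed
  also have "\<dots> = (-2) ^ p * 2 ^ Suc p * homog E (n - p - Suc p) p (Suc p)"
    by (simp only: sum_sign_weight[OF finite_atLeastAtMost] U p) simp
  also have "\<dots> = 2 * ((-1) ^ p * (4 ^ p * homog e0_abs_coeff (n - 1 - 2 * p) p p))"
  proof -
    have "(-2) ^ p * 2 ^ Suc p = 2 * ((-1) ^ p * (4::rat) ^ p)"
      using neg2_power[of p] by simp
    moreover have "n - p - Suc p = n - 1 - 2 * p" by simp
    ultimately show ?thesis unfolding E_def homog_shift by simp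
  qed
  also have "\<dots> = (if even n then 0 else 2 * rho0_coeff n (Suc p))"
  proof (cases "even n")
    case False
    then obtain m where m: "n = 2 * m + 1" by (auto elim: oddE)
    then obtain a where "m = p + a" using le le_Suc_ex[of p m] by auto
    then have n: "n = 2 * (p + a) + 1" using m by simp
    have "4 ^ p * homog e0_abs_coeff (2 * a) p p = rho0_abs_coeff p a"
      by (rule homog_even_eq[OF e0_abs_coeff_pascal rho0_abs_coeff_pascal e0_abs_coeff_diag])
    then show ?thesis using False n rho0_coeff_eq[of p a] by simp
  next
    case True
    then have "homog e0_abs_coeff (n - 1 - 2 * p) p p = 0"
      using le by (intro homog_odd_eq_0 e0_abs_coeff_swap) simp
    then show ?thesis using True by simp
  qed
  finally show ?thesis by (simp add: p_def)
qed

section \<open>The fibres of the map forgetting signs\<close>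

lemma signed_lift_permutes:
  assumes "\<sigma> permutes {1..n}" "S \<subseteq> {1..n}"
  shows "signed_lift \<sigma> S permutes ({- int n..int n} - {0})"
proof (rule bij_imp_permutes)
  let ?U = "{- int n..int n} - {0}"
  have abs: "\<bar>signed_lift \<sigma> S x\<bar> = int (\<sigma> (nat \<bar>x\<bar>))" if "x \<noteq> 0" for x
    using that by (auto simp: signed_lift_def abs_mult abs_sgn_eq)
  have odd: "signed_lift \<sigma> S (- x) = - signed_lift \<sigma> S x" for x
    by (simp add: signed_lift_def)
  have "signed_lift \<sigma> S ` ?U \<subseteq> ?U"
  proof
    fix y assume "y \<in> signed_lift \<sigma> S ` ?U"
    then obtain x where x: "x \<in> ?U" "y = signed_lift \<sigma> S x" by blast
    have "1 \<le> \<sigma> (nat \<bar>x\<bar>) \<and> \<sigma> (nat \<bar>x\<bar>) \<le> n"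
      unfolding permutes_interval_range[OF assms(1)] using x by auto
    then have "1 \<le> \<bar>y\<bar> \<and> \<bar>y\<bar> \<le> int n" using abs[of x] x by auto
    then show "y \<in> ?U" by auto
  qed
  moreover have "inj_on (signed_lift \<sigma> S) ?U"
  proof (rule inj_onI)
    fix x y assume xy: "x \<in> ?U" "y \<in> ?U" "signed_lift \<sigma> S x = signed_lift \<sigma> S y"
    then have "\<sigma> (nat \<bar>x\<bar>) = \<sigma> (nat \<bar>y\<bar>)" using abs[of x] abs[of y] by auto
    then have "nat \<bar>x\<bar> = nat \<bar>y\<bar>" using permutes_inj[OF assms(1)] by (simp add: inj_eq)
    moreover have "x \<noteq> - y"
    proof
      assume "x = - y"
      then have "signed_lift \<sigma> S y = 0" using xy odd[of y] by simp
      then have "\<sigma> (nat \<bar>y\<bar>) = 0" using abs[of y] xy by simp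
      then show False using permutes_interval_pos[OF assms(1), of "nat \<bar>y\<bar>"] xy by simp
    qed
    ultimately show "x = y" by linarith
  qed
  ultimately show "bij_betw (signed_lift \<sigma> S) ?U ?U"
    by (simp add: bij_betw_def endo_inj_surj)
next
  fix x assume x: "x \<notin> {- int n..int n} - {0}"
  then have "nat \<bar>x\<bar> \<notin> {1..n}" by auto
  then have "\<sigma> (nat \<bar>x\<bar>) = nat \<bar>x\<bar>" "nat \<bar>x\<bar> \<notin> S" using assms by (auto simp: permutes_not_in)
  then show "signed_lift \<sigma> S x = x" by (simp add: signed_lift_def sgn_mult_abs)
qed

lemma forget_signs_permutes:
  assumes "\<tau> \<in> signed_perms n"
  shows "forget_signs \<tau> permutes {1..n}"
proof (rule bij_imp_permutes)
  have t: "\<tau> permutes ({- int n..int n} - {0})" and odd: "\<tau> (- i) = - \<tau> i" for i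
    using assms by (auto simp: signed_perms_def)
  have "forget_signs \<tau> ` {1..n} \<subseteq> {1..n}"
  proof
    fix y assume "y \<in> forget_signs \<tau> ` {1..n}"
    then obtain x where x: "x \<in> {1..n}" "y = forget_signs \<tau> x" by blast
    then have "\<tau> (int x) \<in> {- int n..int n} - {0}" using permutes_in_image[OF t] by auto
    then show "y \<in> {1..n}" using x by (auto simp: forget_signs_def)
  qed
  moreover have "inj_on (forget_signs \<tau>) {1..n}"
  proof (rule inj_onI)
    fix x y assume xy: "x \<in> {1..n}" "y \<in> {1..n}" "forget_signs \<tau> x = forget_signs \<tau> y"
    then have "\<tau> (int x) = \<tau> (int y) \<or> \<tau> (int x) = \<tau> (- int y)"
      by (simp add: forget_signs_def odd) linarith
    then have "int x = int y \<or> int x = - int y" using permutes_inj[OF t] by (auto simp: inj_eq)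
    then show "x = y" using xy by auto
  qed
  ultimately show "bij_betw (forget_signs \<tau>) {1..n} {1..n}"
    by (simp add: bij_betw_def endo_inj_surj)
next
  fix x assume "x \<notin> {1..n}"
  then have "int x \<notin> {- int n..int n} - {0}" by auto
  then have "\<tau> (int x) = int x" using assms by (auto simp: signed_perms_def permutes_not_in)
  then show "forget_signs \<tau> x = x" by (simp add: forget_signs_def)
qed

lemma bij_betw_signed_lift:
  assumes "\<sigma> permutes {1..n}"
  shows "bij_betw (signed_lift \<sigma>) (Pow {1..n}) {\<tau> \<in> signed_perms n. forget_signs \<tau> = \<sigma>}"
proof (rule bij_betw_byWitness[where f' = "\<lambda>\<tau>. {v \<in> {1..n}. \<tau> (int v) < 0}"])
  show "\<forall>S\<in>Pow {1..n}. {v \<in> {1..n}. signed_lift \<sigma> S (int v) < 0} = S"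
  proof
    fix S assume S: "S \<in> Pow {1..n}"
    have "signed_lift \<sigma> S (int v) < 0 \<longleftrightarrow> v \<in> S" if "v \<in> {1..n}" for v
      using that permutes_interval_pos[OF assms, of v] by (auto simp: signed_lift_def)
    then show "{v \<in> {1..n}. signed_lift \<sigma> S (int v) < 0} = S" using S by auto
  qed
  show "signed_lift \<sigma> ` Pow {1..n} \<subseteq> {\<tau> \<in> signed_perms n. forget_signs \<tau> = \<sigma>}"
  proof
    fix \<tau> assume "\<tau> \<in> signed_lift \<sigma> ` Pow {1..n}"
    then obtain S where S: "S \<subseteq> {1..n}" "\<tau> = signed_lift \<sigma> S" by blast
    have "forget_signs \<tau> v = \<sigma> v" for v
      using permutes_interval_0[OF assms] by (cases "v = 0") (auto simp: forget_signs_def S signed_lift_def)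
    moreover have "\<tau> \<in> signed_perms n"
      using signed_lift_permutes[OF assms S(1)] by (auto simp: signed_perms_def S(2) signed_lift_def)
    ultimately show "\<tau> \<in> {\<tau> \<in> signed_perms n. forget_signs \<tau> = \<sigma>}" by auto
  qed
  show "\<forall>\<tau>\<in>{\<tau> \<in> signed_perms n. forget_signs \<tau> = \<sigma>}. signed_lift \<sigma> {v \<in> {1..n}. \<tau> (int v) < 0} = \<tau>"
  proof (intro ballI ext)
    fix \<tau> x assume "\<tau> \<in> {\<tau> \<in> signed_perms n. forget_signs \<tau> = \<sigma>}"
    then have t: "\<tau> permutes ({- int n..int n} - {0})" and odd: "\<tau> (- i) = - \<tau> i"
      and f: "\<sigma> v = nat \<bar>\<tau> (int v)\<bar>" for i v
      by (auto simp: signed_perms_def forget_signs_def)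
    have neg: "v \<in> {1..n} \<and> \<tau> (int v) < 0 \<longleftrightarrow> \<tau> (int v) < 0" for v
    proof -
      have "v \<in> {1..n}" if "\<tau> (int v) < 0"
      proof (rule ccontr)
        assume "v \<notin> {1..n}"
        then have "int v \<notin> {- int n..int n} - {0}" by auto
        then show False using that permutes_not_in[OF t] by simp
      qed
      then show ?thesis by blast
    qed
    have "\<tau> 0 = 0" using odd[of 0] by simp
    then show "signed_lift \<sigma> {v \<in> {1..n}. \<tau> (int v) < 0} x = \<tau> x"
      unfolding signed_lift_def mem_Collect_eq neg f using odd[of x] by (cases "x \<ge> 0") (auto simp: sgn_if)
  qed
qed blast

lemma Des_signed_lift:
  assumes "\<sigma> permutes {1..n}" "S \<subseteq> {1..n}"
  shows "Des n (signed_lift \<sigma> S) = lift_des n \<sigma> S"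
proof -
  have "signed_lift \<sigma> S (int i) > signed_lift \<sigma> S (int i + 1)
      \<longleftrightarrow> (if i \<in> desc n \<sigma> then i \<notin> S else Suc i \<in> S)" if "i < n" for i
  proof -
    have v: "signed_lift \<sigma> S (int j) = (if j \<in> S then - int (\<sigma> j) else int (\<sigma> j))" for j
      using permutes_interval_0[OF assms(1)] by (cases "j = 0") (auto simp: signed_lift_def)
    have i1: "int i + 1 = int (Suc i)" by simp
    have ne: "\<sigma> (Suc i) \<noteq> \<sigma> i" using permutes_inj[OF assms(1)] by (simp add: inj_eq)
    have d: "i \<in> desc n \<sigma> \<longleftrightarrow> \<sigma> (Suc i) < \<sigma> i"
      using not_desc_iff[OF assms(1) that] ne by auto
    show ?thesis unfolding i1 v d using ne permutes_interval_pos[OF assms(1), of "Suc i"] by auto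
  qed
  then show ?thesis by (auto simp: Des_def lift_des_def)
qed

section \<open>Sorting words with alternating tie-breaking\<close>

text \<open>Letters are sorted in decreasing order so that the direction in which ties are broken depends
  on the parity of the letter only, and not on the size of the alphabet.\<close>

definition sort_less :: "(nat \<Rightarrow> nat) \<Rightarrow> nat \<Rightarrow> nat \<Rightarrow> bool" where
  "sort_less F v w \<longleftrightarrow> F w < F v \<or> F v = F w \<and> (if even (F v) then v < w else w < v)"

definition sorts :: "nat \<Rightarrow> (nat \<Rightarrow> nat) \<Rightarrow> (nat \<Rightarrow> nat) \<Rightarrow> bool" where
  "sorts n F \<sigma> \<longleftrightarrow> \<sigma> permutes {1..n} \<and> (\<forall>i\<in>{1..<n}. sort_less F (\<sigma> i) (\<sigma> (Suc i)))"

definition words :: "nat \<Rightarrow> nat \<Rightarrow> (nat \<Rightarrow> nat) set" where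
  "words n N = {1..n} \<rightarrow>\<^sub>E {..<N}"

text \<open>The coefficient of \<sigma> in the sum \<open>X_N\<close> of all sorting
  permutations.\<close>

definition sort_count :: "nat \<Rightarrow> nat \<Rightarrow> (nat \<Rightarrow> nat) \<Rightarrow> nat" where
  "sort_count n N \<sigma> = card {F \<in> words n N. sorts n F \<sigma>}"

lemma finite_words: "finite (words n N)"
  by (simp add: words_def finite_PiE)

section \<open>Existence and uniqueness of the sorting permutation\<close>

lemma sort_less_irrefl: "\<not> sort_less F v v"
  by (simp add: sort_less_def)

lemma sort_less_trans: "sort_less F u v \<Longrightarrow> sort_less F v w \<Longrightarrow> sort_less F u w"
  by (auto simp: sort_less_def split: if_splits)

lemma sort_less_total: "v \<noteq> w \<Longrightarrow> sort_less F v w \<or> sort_less F w v"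
  by (auto simp: sort_less_def)

lemma sort_less_cong: "F v = F' v \<Longrightarrow> F w = F' w \<Longrightarrow> sort_less F v w = sort_less F' v w"
  by (simp add: sort_less_def)

lemma sorts_cong:
  assumes "\<And>v. v \<in> {1..n} \<Longrightarrow> F v = F' v"
  shows "sorts n F \<sigma> = sorts n F' \<sigma>"
proof (cases "\<sigma> permutes {1..n}")
  case True
  have "sort_less F (\<sigma> i) (\<sigma> (Suc i)) = sort_less F' (\<sigma> i) (\<sigma> (Suc i))" if "i \<in> {1..<n}" for i
    using that permutes_in_image[OF True] by (intro sort_less_cong assms) auto
  then show ?thesis by (auto simp: sorts_def)
qed (simp add: sorts_def)

lemma sorts_less:
  assumes "sorts n F \<sigma>" "1 \<le> i" "i < j" "j \<le> n"
  shows "sort_less F (\<sigma> i) (\<sigma> j)"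
  using assms(3,4)
proof (induction j)
  case (Suc j)
  have step: "sort_less F (\<sigma> j) (\<sigma> (Suc j))" if "1 \<le> j"
    using assms(1) Suc.prems that by (auto simp: sorts_def)
  show ?case
  proof (cases "i = j")
    case True
    then show ?thesis using step assms(2) by simp
  next
    case False
    then have "sort_less F (\<sigma> i) (\<sigma> j)" using Suc by simp
    then show ?thesis using step assms(2) False Suc.prems sort_less_trans[of F "\<sigma> i" "\<sigma> j"] by simp
  qed
qed simp

text \<open>The entries before \<open>\<sigma> i\<close> are exactly those sorted below it. So the
  place of an entry is its rank, which depends on \<open>F\<close> alone; this yields
  uniqueness.\<close>

lemma sorts_rank:
  assumes "sorts n F \<sigma>" "i \<in> {1..n}"
  shows "card {w \<in> {1..n}. sort_less F w (\<sigma> i)} = i - 1"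
proof -
  have s: "\<sigma> permutes {1..n}" using assms by (simp add: sorts_def)
  have "{w \<in> {1..n}. sort_less F w (\<sigma> i)} = \<sigma> ` {1..<i}"
  proof (intro equalityI subsetI)
    fix w assume w: "w \<in> {w \<in> {1..n}. sort_less F w (\<sigma> i)}"
    then have "w \<in> \<sigma> ` {1..n}" using permutes_image[OF s] by simp
    then obtain k where k: "k \<in> {1..n}" "w = \<sigma> k" by blast
    have "k < i"
    proof (rule ccontr)
      assume "\<not> k < i"
      then consider "k = i" | "i < k" by linarith
      then have "k = i \<or> sort_less F (\<sigma> i) (\<sigma> k)"
        by cases (use sorts_less[OF assms(1), of i k] assms(2) k in auto)
      then show False using w k sort_less_trans sort_less_irrefl by blast
    qed
    then show "w \<in> \<sigma> ` {1..<i}" using k by auto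
  next
    fix w assume "w \<in> \<sigma> ` {1..<i}"
    then obtain k where k: "k \<in> {1..<i}" "w = \<sigma> k" by blast
    then have "k \<in> {1..n}" using assms(2) by auto
    then show "w \<in> {w \<in> {1..n}. sort_less F w (\<sigma> i)}"
      using k sorts_less[OF assms(1), of k i] assms(2) permutes_in_image[OF s, of k] by auto
  qed
  then show ?thesis by (simp add: card_image permutes_inj_on[OF s])
qed

lemma sorts_unique:
  assumes "sorts n F \<sigma>" "sorts n F \<tau>"
  shows "\<sigma> = \<tau>"
proof
  fix i
  have s: "\<sigma> permutes {1..n}" and t: "\<tau> permutes {1..n}" using assms by (simp_all add: sorts_def)
  show "\<sigma> i = \<tau> i"
  proof (cases "i \<in> {1..n}")
    case True
    then have "\<sigma> i \<in> \<tau> ` {1..n}" using permutes_image[OF t] permutes_in_image[OF s] by blast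
    then obtain j where j: "j \<in> {1..n}" "\<sigma> i = \<tau> j" by blast
    have "i - 1 = j - 1" using sorts_rank[OF assms(1) True] sorts_rank[OF assms(2) j(1)] j(2) by simp
    then have "i = j" using True j(1) by auto
    then show ?thesis using j by simp
  next
    case False
    then show ?thesis using permutes_not_in[OF s] permutes_not_in[OF t] by metis
  qed
qed

lemma sorts_exists: "\<exists>\<sigma>. sorts n F \<sigma>"
proof -
  \<comment> \<open>The map sends an entry to its rank and is the identity outside
    \<open>{1..n}\<close>; its inverse is the sorting permutation.\<close>
  define r where "r v = (if v \<in> {1..n} then Suc (card {w \<in> {1..n}. sort_less F w v}) else v)" for v
  have mono: "r v < r w" if "v \<in> {1..n}" "w \<in> {1..n}" "sort_less F v w" for v w
  proof -
    have "{u \<in> {1..n}. sort_less F u v} \<subset> {u \<in> {1..n}. sort_less F u w}"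
      using that sort_less_trans[of F _ v w] sort_less_irrefl[of F v] by blast
    then show ?thesis using that by (simp add: r_def psubset_card_mono)
  qed
  have "r permutes {1..n}"
  proof (rule bij_imp_permutes)
    have "inj_on r {1..n}"
    proof (rule inj_onI)
      fix v w assume "v \<in> {1..n}" "w \<in> {1..n}" "r v = r w"
      then show "v = w" using sort_less_total[of v w F] mono by (metis less_irrefl)
    qed
    moreover have "r ` {1..n} \<subseteq> {1..n}"
    proof
      fix y assume "y \<in> r ` {1..n}"
      then obtain v where v: "v \<in> {1..n}" "y = r v" by blast
      have "{w \<in> {1..n}. sort_less F w v} \<subset> {1..n}" using v sort_less_irrefl[of F v] by blast
      then have "card {w \<in> {1..n}. sort_less F w v} < card {1..n}" by (intro psubset_card_mono) simp
      then show "y \<in> {1..n}" using v by (simp add: r_def)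
    qed
    ultimately show "bij_betw r {1..n} {1..n}" by (simp add: bij_betw_def endo_inj_surj)
  qed (auto simp: r_def)
  then have s: "inv' r permutes {1..n}" and r: "r (inv' r i) = i" for i
    by (simp_all add: permutes_inv permutes_inverses)
  have "sort_less F (inv' r i) (inv' r (Suc i))" if i: "i \<in> {1..<n}" for i
  proof (rule ccontr)
    have m: "inv' r i \<in> {1..n}" "inv' r (Suc i) \<in> {1..n}" using i permutes_in_image[OF s] by auto
    assume "\<not> ?thesis"
    then have "inv' r i = inv' r (Suc i) \<or> sort_less F (inv' r (Suc i)) (inv' r i)"
      using sort_less_total by blast
    then show False
      using mono[OF m(2,1)] r[of i] r[of "Suc i"] by auto
  qed
  then show ?thesis using s by (auto simp: sorts_def)
qed

definition sort_perm :: "nat \<Rightarrow> (nat \<Rightarrow> nat) \<Rightarrow> nat \<Rightarrow> nat" where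
  "sort_perm n F = (THE \<sigma>. sorts n F \<sigma>)"

lemma sorts_iff: "sorts n F \<sigma> \<longleftrightarrow> sort_perm n F = \<sigma>"
proof -
  have "\<exists>!\<sigma>. sorts n F \<sigma>" using sorts_exists sorts_unique by blast
  then show ?thesis unfolding sort_perm_def by (metis theI')
qed

lemma sort_perm_permutes: "sort_perm n F permutes {1..n}"
  using sorts_iff[of n F "sort_perm n F"] by (simp add: sorts_def)

section \<open>Lexicographic products of words and composition of sorts\<close>

text \<open>Blocks with an odd letter are traversed backwards. As parities of letters add up, this
  turns the lexicographic product of two alternating chains into an alternating chain.\<close>

definition letter_pair :: "nat \<Rightarrow> nat \<Rightarrow> nat \<Rightarrow> nat" where
  "letter_pair N a b = a * N + (if even a then b else N - 1 - b)"

definition letter_snd :: "nat \<Rightarrow> nat \<Rightarrow> nat" where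
  "letter_snd N c = (if even (c div N) then c mod N else N - 1 - c mod N)"

lemma letter_pair_div: "b < N \<Longrightarrow> letter_pair N a b div N = a"
  by (auto simp: letter_pair_def)

lemma letter_snd_pair: "b < N \<Longrightarrow> letter_snd N (letter_pair N a b) = b"
proof -
  assume b: "b < N"
  define r where "r = (if even a then b else N - 1 - b)"
  have "r < N" using b by (auto simp: r_def)
  then have "letter_pair N a b mod N = r" by (simp add: letter_pair_def r_def[symmetric])
  then show ?thesis using b by (simp add: letter_snd_def letter_pair_div r_def)
qed

lemma letter_pair_snd: "0 < N \<Longrightarrow> letter_pair N (c div N) (letter_snd N c) = c"
proof -
  assume "0 < N"
  then have "c mod N < N" by simp
  then have "N - 1 - (N - 1 - c mod N) = c mod N" by linarith
  then show ?thesis by (simp add: letter_pair_def letter_snd_def)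
qed

lemma letter_pair_less: "a < a' \<Longrightarrow> b < N \<Longrightarrow> b' < N \<Longrightarrow> letter_pair N a b < letter_pair N a' b'"
proof -
  assume h: "a < a'" "b < N" "b' < N"
  have "letter_pair N a b < Suc a * N" using h by (auto simp: letter_pair_def)
  also have "\<dots> \<le> a' * N" using h by (intro mult_right_mono) auto
  also have "\<dots> \<le> letter_pair N a' b'" by (simp add: letter_pair_def)
  finally show ?thesis .
qed

text \<open>For odd \<open>a\<close> the letter is \<open>(a + 1) * N - 1 - b\<close> with
  \<open>(a + 1) * N\<close> even, so the parity of \<open>N\<close> drops out.\<close>

lemma even_letter_pair: "b < N \<Longrightarrow> even (letter_pair N a b) \<longleftrightarrow> even a = even b"
  by (auto simp: letter_pair_def)

text \<open>Here \<open>G\<close> is a word on the places of the list sorted by \<open>F\<close>.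
  Sorting by \<open>G\<close> with ties resolved by place keeps the order of \<open>F\<close> inside
  a block with an even letter and reverses it inside one with an odd letter, which is what
  \<open>letter_pair\<close> encodes.\<close>

lemma sorts_comp:
  assumes F: "sorts n F \<sigma>" and G: "sorts n G \<tau>" and N: "\<And>v. v \<in> {1..n} \<Longrightarrow> F v < N"
  shows "sorts n (\<lambda>w. letter_pair N (G (inv' \<sigma> w)) (F w)) (\<sigma> \<circ> \<tau>)"
  unfolding sorts_def
proof (intro conjI ballI)
  have s: "\<sigma> permutes {1..n}" and t: "\<tau> permutes {1..n}" using F G by (auto simp: sorts_def)
  then show "\<sigma> \<circ> \<tau> permutes {1..n}" by (simp add: permutes_compose)
  fix i assume i: "i \<in> {1..<n}"
  define v w where "v = \<tau> i" and "w = \<tau> (Suc i)"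
  have vw: "v \<in> {1..n}" "w \<in> {1..n}" unfolding v_def w_def permutes_in_image[OF t] using i by auto
  then have "\<sigma> v \<in> {1..n}" "\<sigma> w \<in> {1..n}" unfolding permutes_in_image[OF s] by auto
  then have lt: "F (\<sigma> v) < N" "F (\<sigma> w) < N" using N by auto
  have less: "sort_less G v w" using G i by (simp add: sorts_def v_def w_def)
  have inv: "inv' \<sigma> (\<sigma> u) = u" for u using permutes_inverses(2)[OF s] .
  define H where "H = (\<lambda>w. letter_pair N (G (inv' \<sigma> w)) (F w))"
  have H: "H (\<sigma> u) = letter_pair N (G u) (F (\<sigma> u))" for u by (simp add: H_def inv)
  have "sort_less H (\<sigma> v) (\<sigma> w)"
  proof (cases "G w < G v")
    case True
    then show ?thesis using letter_pair_less[OF True lt(2,1)] by (simp add: sort_less_def H)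
  next
    case False
    then have eq: "G v = G w" using less by (auto simp: sort_less_def)
    show ?thesis
    proof (cases "even (G v)")
      case True
      then have "v < w" using less eq by (simp add: sort_less_def)
      then have "sort_less F (\<sigma> v) (\<sigma> w)" using sorts_less[OF F] vw by auto
      then show ?thesis using True eq lt unfolding sort_less_def H
        by (auto simp: even_letter_pair) (auto simp: letter_pair_def)
    next
      case False
      then have "w < v" using less eq by (simp add: sort_less_def)
      then have "sort_less F (\<sigma> w) (\<sigma> v)" using sorts_less[OF F] vw by auto
      then show ?thesis using False eq lt unfolding sort_less_def H
        by (auto simp: even_letter_pair split: if_splits) (auto simp: letter_pair_def)
    qed
  qed
  then show "sort_less (\<lambda>w. letter_pair N (G (inv' \<sigma> w)) (F w)) ((\<sigma> \<circ> \<tau>) i) ((\<sigma> \<circ> \<tau>) (Suc i))"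
    by (simp add: H_def v_def w_def)
qed

lemma words_undefined: "F \<in> words n N \<Longrightarrow> v \<notin> {1..n} \<Longrightarrow> F v = undefined"
  unfolding words_def by (rule PiE_arb)

lemma words_comp: "F \<in> words n N \<Longrightarrow> \<sigma> permutes {1..n} \<Longrightarrow> F \<circ> \<sigma> \<in> words n N"
proof -
  assume F: "F \<in> words n N" and s: "\<sigma> permutes {1..n}"
  have "F (\<sigma> v) < N" if "v \<in> {1..n}" for v
  proof -
    have "\<sigma> v \<in> {1..n}" using that by (simp only: permutes_in_image[OF s])
    then show ?thesis using F by (auto simp: words_def)
  qed
  moreover have "F (\<sigma> v) = undefined" if "v \<notin> {1..n}" for v
    using permutes_not_in[OF s that] words_undefined[OF F that] by simp
  ultimately show ?thesis by (auto simp: words_def PiE_def extensional_def)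
qed

definition word_pair :: "nat \<Rightarrow> nat \<Rightarrow> (nat \<Rightarrow> nat) \<times> (nat \<Rightarrow> nat) \<Rightarrow> nat \<Rightarrow> nat" where
  "word_pair n N = (\<lambda>(F, G). restrict (\<lambda>w. letter_pair N (G (inv' (sort_perm n F) w)) (F w)) {1..n})"

text \<open>The first word has to be recovered before the second, whose letters are indexed by
  places in the order sorted by the first.\<close>

definition word_unpair :: "nat \<Rightarrow> nat \<Rightarrow> (nat \<Rightarrow> nat) \<Rightarrow> (nat \<Rightarrow> nat) \<times> (nat \<Rightarrow> nat)" where
  "word_unpair n N H = (let F = restrict (\<lambda>w. letter_snd N (H w)) {1..n}
     in (F, restrict (\<lambda>w. H w div N) {1..n} \<circ> sort_perm n F))"

lemma sort_perm_word_pair: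
  assumes "F \<in> words n N"
  shows "sort_perm n (word_pair n N (F, G)) = sort_perm n F \<circ> sort_perm n G"
proof -
  have "sorts n (\<lambda>w. letter_pair N (G (inv' (sort_perm n F) w)) (F w)) (sort_perm n F \<circ> sort_perm n G)"
    using assms by (intro sorts_comp) (auto simp: sorts_iff words_def)
  then have "sorts n (word_pair n N (F, G)) (sort_perm n F \<circ> sort_perm n G)"
    by (subst sorts_cong[where F' = "\<lambda>w. letter_pair N (G (inv' (sort_perm n F) w)) (F w)"])
       (auto simp: word_pair_def)
  then show ?thesis by (simp add: sorts_iff)
qed

lemma word_unpair_pair:
  assumes "F \<in> words n N" "G \<in> words n M"
  shows "word_unpair n N (word_pair n N (F, G)) = (F, G)"
proof -
  define H where "H = word_pair n N (F, G)"
  have lt: "F w < N" if "w \<in> {1..n}" for w using assms that by (auto simp: words_def)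
  have Hw: "H w = letter_pair N (G (inv' (sort_perm n F) w)) (F w)" if "w \<in> {1..n}" for w
    using that by (simp add: H_def word_pair_def)
  have 1: "restrict (\<lambda>w. letter_snd N (H w)) {1..n} = F"
  proof
    fix w show "restrict (\<lambda>w. letter_snd N (H w)) {1..n} w = F w"
    proof (cases "w \<in> {1..n}")
      case True
      then show ?thesis by (simp only: restrict_apply' Hw letter_snd_pair lt)
    next
      case False
      then show ?thesis using words_undefined[OF assms(1) False] by (simp only: restrict_def if_False)
    qed
  qed
  let ?s = "sort_perm n F"
  have s: "?s permutes {1..n}" by (rule sort_perm_permutes)
  have "(restrict (\<lambda>w. H w div N) {1..n} \<circ> ?s) v = G v" for v
  proof (cases "v \<in> {1..n}")
    case True
    then have "?s v \<in> {1..n}" by (simp only: permutes_in_image[OF s])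
    then show ?thesis
      by (simp only: o_apply restrict_apply' Hw letter_pair_div lt permutes_inverses(2)[OF s])
  next
    case False
    then show ?thesis using words_undefined[OF assms(2) False]
      by (simp only: o_apply permutes_not_in[OF s False] restrict_def if_False)
  qed
  then have "restrict (\<lambda>w. H w div N) {1..n} \<circ> ?s = G" by auto
  then show ?thesis unfolding H_def[symmetric] word_unpair_def Let_def 1 by simp
qed

lemma word_pair_unpair:
  assumes "H \<in> words n (M * N)"
  shows "word_pair n N (word_unpair n N H) = H"
proof
  fix w
  define F where "F = restrict (\<lambda>w. letter_snd N (H w)) {1..n}"
  let ?s = "sort_perm n F"
  have s: "?s permutes {1..n}" by (rule sort_perm_permutes)
  show "word_pair n N (word_unpair n N H) w = H w"
  proof (cases "w \<in> {1..n}")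
    case True
    then have "H w < M * N" using assms by (auto simp: words_def)
    then have "0 < N" by (cases N) auto
    then have "letter_pair N (H w div N) (letter_snd N (H w)) = H w" by (rule letter_pair_snd)
    then show ?thesis
      unfolding word_unpair_def Let_def F_def[symmetric] word_pair_def prod.case
      by (simp only: restrict_apply' True o_apply permutes_inverses(1)[OF s] F_def[THEN fun_cong])
  next
    case False
    then show ?thesis using words_undefined[OF assms, of w] by (auto simp: word_pair_def word_unpair_def Let_def)
  qed
qed

lemma word_pair_in_words:
  assumes "F \<in> words n N" "G \<in> words n M"
  shows "word_pair n N (F, G) \<in> words n (M * N)"
proof -
  let ?s = "sort_perm n F"
  have s: "inv' ?s permutes {1..n}" by (intro permutes_inv sort_perm_permutes)
  have "letter_pair N (G (inv' ?s w)) (F w) < M * N" if "w \<in> {1..n}" for w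
  proof -
    have "inv' ?s w \<in> {1..n}" using that by (simp only: permutes_in_image[OF s])
    then have G: "G (inv' ?s w) < M" using assms by (auto simp: words_def)
    have F: "F w < N" using assms that by (auto simp: words_def)
    have "letter_pair N (G (inv' ?s w)) (F w) < Suc (G (inv' ?s w)) * N"
      using F by (auto simp: letter_pair_def)
    also have "\<dots> \<le> M * N" using G by (intro mult_right_mono) auto
    finally show ?thesis .
  qed
  then show ?thesis by (auto simp: words_def word_pair_def)
qed

lemma word_unpair_in_words:
  assumes "H \<in> words n (M * N)"
  shows "word_unpair n N H \<in> words n N \<times> words n M"
proof -
  have b: "letter_snd N (H w) < N \<and> H w div N < M" if "w \<in> {1..n}" for w
  proof -
    have h: "H w < M * N" using that assms by (auto simp: words_def)
    then have "0 < N" by (cases N) auto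
    then have "H w mod N < N" by simp
    then have "letter_snd N (H w) < N" using \<open>0 < N\<close> unfolding letter_snd_def by (simp split: if_split)
    then show ?thesis using h by (simp add: less_mult_imp_div_less)
  qed
  have 1: "restrict (\<lambda>w. letter_snd N (H w)) {1..n} \<in> words n N"
    and 2: "restrict (\<lambda>w. H w div N) {1..n} \<in> words n M" using b by (auto simp: words_def)
  show ?thesis unfolding word_unpair_def Let_def
    using 1 words_comp[OF 2 sort_perm_permutes] by blast
qed

text \<open>This is \<open>X_N X_M = X_NM\<close> read at \<rho>. Pairs of words whose sorting
  permutations compose to \<rho> are grouped by the first permutation, and \<open>word_pair\<close>
  matches them with the words over \<open>M * N\<close> letters sorted by \<rho>.\<close>

lemma sort_count_mult:
  assumes "\<rho> permutes {1..n}"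
  shows "(\<Sum>\<sigma> | \<sigma> permutes {1..n}. sort_count n N \<sigma> * sort_count n M (inv' \<sigma> \<circ> \<rho>)) = sort_count n (M * N) \<rho>"
proof -
  let ?P = "{\<sigma>. \<sigma> permutes {1..n}}"
  define X where "X = {p \<in> words n N \<times> words n M. sort_perm n (fst p) \<circ> sort_perm n (snd p) = \<rho>}"
  have fin: "finite X" unfolding X_def using finite_words by auto
  have "sort_count n N \<sigma> * sort_count n M (inv' \<sigma> \<circ> \<rho>) = (\<Sum>p \<in> {p \<in> X. sort_perm n (fst p) = \<sigma>}. 1)"
    if s: "\<sigma> permutes {1..n}" for \<sigma>
  proof -
    have "{F \<in> words n N. sort_perm n F = \<sigma>} \<times> {G \<in> words n M. sort_perm n G = inv' \<sigma> \<circ> \<rho>}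
        = {p \<in> X. sort_perm n (fst p) = \<sigma>}"
    proof -
      have *: "\<tau> = inv' \<sigma> \<circ> \<rho> \<longleftrightarrow> \<sigma> \<circ> \<tau> = \<rho>" for \<tau>
        using permutes_inv_o[OF s] by (metis comp_assoc comp_id id_comp)
      show ?thesis unfolding X_def * by auto
    qed
    then show ?thesis by (simp add: sort_count_def sorts_iff flip: card_cartesian_product)
  qed
  then have "(\<Sum>\<sigma>\<in>?P. sort_count n N \<sigma> * sort_count n M (inv' \<sigma> \<circ> \<rho>))
      = (\<Sum>\<sigma>\<in>?P. \<Sum>p \<in> {p \<in> X. sort_perm n (fst p) = \<sigma>}. 1)" by (intro sum.cong) auto
  also have "\<dots> = (\<Sum>p\<in>X. 1)"
    using sort_perm_permutes[of n] by (intro sum.group) (auto simp: fin finite_permutations)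
  also have "\<dots> = card X" by simp
  also have "\<dots> = sort_count n (M * N) \<rho>"
    unfolding sort_count_def sorts_iff
  proof (rule bij_betw_same_card[of "word_pair n N"], rule bij_betw_byWitness[where f' = "word_unpair n N"])
    show "\<forall>p\<in>X. word_unpair n N (word_pair n N p) = p"
      by (auto simp: X_def word_unpair_pair)
    show "\<forall>H\<in>{H \<in> words n (M * N). sort_perm n H = \<rho>}. word_pair n N (word_unpair n N H) = H"
      by (auto simp: word_pair_unpair)
    show "word_pair n N ` X \<subseteq> {H \<in> words n (M * N). sort_perm n H = \<rho>}"
      by (auto simp: X_def word_pair_in_words sort_perm_word_pair)
    show "word_unpair n N ` {H \<in> words n (M * N). sort_perm n H = \<rho>} \<subseteq> X"
    proof
      fix p assume "p \<in> word_unpair n N ` {H \<in> words n (M * N). sort_perm n H = \<rho>}"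
      then obtain H where H: "H \<in> words n (M * N)" "sort_perm n H = \<rho>" "p = word_unpair n N H" by blast
      obtain F G where p: "p = (F, G)" by fastforce
      have "(F, G) \<in> words n N \<times> words n M" using word_unpair_in_words[OF H(1)] H(3) p by simp
      moreover have "word_pair n N (F, G) = H" using word_pair_unpair[OF H(1)] H(3) p by simp
      ultimately show "p \<in> X"
        using sort_perm_word_pair[of F n N G] H(2) unfolding X_def p by auto
    qed
  qed
  finally show ?thesis .
qed

section \<open>Counting the words sorted by a permutation\<close>

text \<open>A word sorted by \<open>\<sigma>\<close> consists of its set \<open>S\<close> of odd letters and the chain of its halves;
  the chain has to jump at the descents of the signed lift of \<open>\<sigma>\<close> by \<open>S\<close>.\<close>

definition step_chains :: "nat \<Rightarrow> nat \<Rightarrow> nat set \<Rightarrow> (nat \<Rightarrow> nat) set" where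
  "step_chains n k D = {h \<in> {0..n} \<rightarrow>\<^sub>E {..k}. h 0 = 0 \<and>
     (\<forall>i<n. h i \<le> h (Suc i) \<and> (i \<in> D \<longrightarrow> h i < h (Suc i)))}"

lemma finite_step_chains: "finite (step_chains n k D)"
  by (rule finite_subset[of _ "{0..n} \<rightarrow>\<^sub>E {..k}"]) (auto simp: step_chains_def intro!: finite_PiE)

lemma chains_le_last: "h \<in> step_chains n k D \<Longrightarrow> i \<le> n \<Longrightarrow> h i \<le> h n"
proof -
  assume h: "h \<in> step_chains n k D"
  have "i \<le> j \<Longrightarrow> j \<le> n \<Longrightarrow> h i \<le> h j" for j
  proof (induction j)
    case (Suc j)
    have "h j \<le> h (Suc j)" using h Suc.prems by (simp add: step_chains_def)
    then show ?case using Suc by (cases "i = Suc j") (auto intro: order_trans)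
  qed simp
  then show "i \<le> n \<Longrightarrow> h i \<le> h n" by simp
qed

lemma chains_0: "step_chains 0 k D = {\<lambda>i\<in>{0}. 0}"
  by (auto simp: step_chains_def PiE_def extensional_def restrict_def)

text \<open>Dropping the last value leaves a chain bounded by \<open>k\<close>, or by
  \<open>k - 1\<close> if the last step is strict; a strict step cannot end at 0.\<close>

lemma card_step_chains_top:
  "card {h \<in> step_chains (Suc n) k D. h (Suc n) = k}
    = (if n \<in> D then if k = 0 then 0 else card (step_chains n (k - 1) D) else card (step_chains n k D))"
proof -
  have bij: "card {h \<in> step_chains (Suc n) k D. h (Suc n) = k} = card (step_chains n l D)"
    if l: "\<And>x. x \<le> l \<longleftrightarrow> x \<le> k \<and> (n \<in> D \<longrightarrow> x < k)" for l
  proof (rule bij_betw_same_card[of "\<lambda>h. restrict h {0..n}"],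
         rule bij_betw_byWitness[where f' = "\<lambda>h. h(Suc n := k)"])
    show "\<forall>h\<in>{h \<in> step_chains (Suc n) k D. h (Suc n) = k}. (restrict h {0..n})(Suc n := k) = h"
    proof (intro ballI ext)
      fix h i assume h: "h \<in> {h \<in> step_chains (Suc n) k D. h (Suc n) = k}"
      then have "h i = undefined" if "i > Suc n"
        using that by (auto simp: step_chains_def PiE_def extensional_def)
      then show "((restrict h {0..n})(Suc n := k)) i = h i" using h by (auto simp: restrict_def)
    qed
    show "\<forall>h\<in>step_chains n l D. restrict (h(Suc n := k)) {0..n} = h"
      by (auto simp: step_chains_def PiE_def extensional_def restrict_def fun_eq_iff)
    show "(\<lambda>h. restrict h {0..n}) ` {h \<in> step_chains (Suc n) k D. h (Suc n) = k} \<subseteq> step_chains n l D"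
    proof (intro image_subsetI)
      fix h assume h: "h \<in> {h \<in> step_chains (Suc n) k D. h (Suc n) = k}"
      then have "h n \<le> l" by (auto simp: l step_chains_def)
      moreover have "h i \<le> h n" if "i \<le> n" for i
      proof -
        have "restrict h {0..n} \<in> step_chains n k D" using h by (auto simp: step_chains_def)
        from chains_le_last[OF this that] show ?thesis using that by simp
      qed
      ultimately have "h i \<le> l" if "i \<le> n" for i using that order_trans by blast
      then show "restrict h {0..n} \<in> step_chains n l D" using h by (auto simp: step_chains_def)
    qed
    show "(\<lambda>h. h(Suc n := k)) ` step_chains n l D \<subseteq> {h \<in> step_chains (Suc n) k D. h (Suc n) = k}"
    proof (intro image_subsetI)
      fix h assume h: "h \<in> step_chains n l D"
      then have le: "h i \<le> k" "n \<in> D \<Longrightarrow> h i < k" if "i \<le> n" for i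
        using that l[of "h i"] by (auto simp: step_chains_def)
      have ext: "h i = undefined" if "i > n" for i
        using h that by (auto simp: step_chains_def PiE_def extensional_def)
      show "h(Suc n := k) \<in> {h \<in> step_chains (Suc n) k D. h (Suc n) = k}"
        using h le ext by (auto simp: step_chains_def PiE_def extensional_def less_Suc_eq_le le_less)
    qed
  qed
  show ?thesis
  proof (cases "n \<in> D")
    case True
    show ?thesis
    proof (cases "k = 0")
      case True
      then have "{h \<in> step_chains (Suc n) k D. h (Suc n) = k} = {}" using \<open>n \<in> D\<close> by (auto simp: step_chains_def)
      then have "card {h \<in> step_chains (Suc n) k D. h (Suc n) = k} = 0" by (simp only: card.empty)
      then show ?thesis using True \<open>n \<in> D\<close> by simp
    next
      case False
      then obtain l where "k = Suc l" by (cases k) auto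
      then have "x \<le> l \<longleftrightarrow> x \<le> k \<and> (n \<in> D \<longrightarrow> x < k)" for x using True by auto
      from bij[OF this] show ?thesis using True \<open>k = Suc l\<close> by simp
    qed
  next
    case False
    then show ?thesis using bij[of k] by auto
  qed
qed

lemma card_step_chains_Suc:
  "card (step_chains (Suc n) k D) = card {h \<in> step_chains (Suc n) k D. h (Suc n) = k}
     + (if k = 0 then 0 else card (step_chains (Suc n) (k - 1) D))"
proof -
  have "{h \<in> step_chains (Suc n) k D. h (Suc n) \<noteq> k} = (if k = 0 then {} else step_chains (Suc n) (k - 1) D)"
  proof (cases "k = 0")
    case True
    then show ?thesis by (auto simp: step_chains_def)
  next
    case False
    have "h \<in> step_chains (Suc n) k D \<and> h (Suc n) \<noteq> k \<longleftrightarrow> h \<in> step_chains (Suc n) (k - 1) D" for h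
    proof
      assume h: "h \<in> step_chains (Suc n) k D \<and> h (Suc n) \<noteq> k"
      then have "h (Suc n) \<le> k" by (auto simp: step_chains_def)
      then have "h (Suc n) < k" using h by simp
      then have "h i \<le> k - 1" if "i \<le> Suc n" for i
        using chains_le_last[of h "Suc n" k D i] h that by simp
      then show "h \<in> step_chains (Suc n) (k - 1) D" using h by (auto simp: step_chains_def PiE_def)
    next
      assume h: "h \<in> step_chains (Suc n) (k - 1) D"
      then have "h i \<le> k - 1" if "i \<le> Suc n" for i using that by (auto simp: step_chains_def)
      then have "h i \<le> k \<and> h i \<noteq> k" if "i \<le> Suc n" for i using that False by force
      then show "h \<in> step_chains (Suc n) k D \<and> h (Suc n) \<noteq> k" using h by (auto simp: step_chains_def PiE_def)
    qed
    then show ?thesis using False by auto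
  qed
  moreover have "step_chains (Suc n) k D = {h \<in> step_chains (Suc n) k D. h (Suc n) = k}
      \<union> {h \<in> step_chains (Suc n) k D. h (Suc n) \<noteq> k}" by auto
  then have "card (step_chains (Suc n) k D) = card {h \<in> step_chains (Suc n) k D. h (Suc n) = k}
      + card {h \<in> step_chains (Suc n) k D. h (Suc n) \<noteq> k}"
    using finite_step_chains by (metis (no_types, lifting) card_Un_disjoint disjoint_iff finite_Un mem_Collect_eq)
  ultimately show ?thesis by simp
qed

text \<open>Induction on \<open>n\<close> and, inside it, on \<open>k\<close>: a chain ends at
  \<open>k\<close> or stays below, and Pascal's rule adds the two counts.\<close>

lemma card_step_chains: "card (step_chains n k D) = (n + k - card (D \<inter> {..<n})) choose n"
proof (induction n arbitrary: k)
  case 0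
  show ?case by (simp add: chains_0)
next
  case (Suc n)
  define d where "d = card (D \<inter> {..<n})"
  have d: "d \<le> n" unfolding d_def using card_mono[of "{..<n}" "D \<inter> {..<n}"] by simp
  have d': "card (D \<inter> {..<Suc n}) = (if n \<in> D then Suc d else d)"
    by (simp add: d_def lessThan_Suc Int_insert_right)
  note IH = Suc[folded d_def]
  show ?case unfolding d'
  proof (induction k)
    case 0
    \<comment> \<open>Both sides are 1 if no step is forced and 0 otherwise.\<close>
    have z: "n - d choose n = (Suc n - d choose Suc n)"
      using d by (cases "d = 0") (auto simp: binomial_eq_0)
    show ?case using z d
      by (subst card_step_chains_Suc) (simp add: card_step_chains_top IH binomial_eq_0)
  next
    case (Suc k)
    have 1: "Suc n + Suc k - d = Suc (n + Suc k - d)" "Suc n + k - d = n + Suc k - d"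
      "Suc n + Suc k - Suc d = Suc (n + k - d)" "Suc n + k - Suc d = n + k - d" using d by auto
    show ?case
      by (subst card_step_chains_Suc)
         (use 1 Suc in \<open>auto simp: card_step_chains_top IH simp del: add_Suc add_Suc_right diff_Suc_Suc\<close>)
  qed
qed

section \<open>Sorted words as chains\<close>

definition sorted_words :: "nat \<Rightarrow> nat \<Rightarrow> (nat \<Rightarrow> nat) \<Rightarrow> (nat \<Rightarrow> nat) set" where
  "sorted_words n N \<sigma> = {f \<in> words n N. \<forall>i\<in>{1..<n}. f (Suc i) < f i \<or>
     f i = f (Suc i) \<and> (if even (f i) then \<sigma> i < \<sigma> (Suc i) else \<sigma> (Suc i) < \<sigma> i)}"

text \<open>The word is reread in sorted order: \<open>F \<circ> \<sigma>\<close> has at place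
  \<open>i\<close> the letter of the entry \<open>\<sigma> i\<close>.\<close>

lemma sort_count_eq:
  assumes s: "\<sigma> permutes {1..n}"
  shows "sort_count n N \<sigma> = card (sorted_words n N \<sigma>)"
  unfolding sort_count_def
proof (rule bij_betw_same_card[of "\<lambda>F. F \<circ> \<sigma>"],
       rule bij_betw_byWitness[where f' = "\<lambda>f. f \<circ> inv' \<sigma>"])
  show "\<forall>F\<in>{F \<in> words n N. sorts n F \<sigma>}. F \<circ> \<sigma> \<circ> inv' \<sigma> = F"
    by (simp add: comp_assoc permutes_inv_o[OF s])
  show "\<forall>f\<in>sorted_words n N \<sigma>. f \<circ> inv' \<sigma> \<circ> \<sigma> = f"
    by (simp add: comp_assoc permutes_inv_o[OF s])
  show "(\<lambda>F. F \<circ> \<sigma>) ` {F \<in> words n N. sorts n F \<sigma>} \<subseteq> sorted_words n N \<sigma>"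
    using words_comp[OF _ s] by (auto simp: sorted_words_def sorts_def sort_less_def)
  show "(\<lambda>f. f \<circ> inv' \<sigma>) ` sorted_words n N \<sigma> \<subseteq> {F \<in> words n N. sorts n F \<sigma>}"
    using words_comp[OF _ permutes_inv[OF s]] s
    by (auto simp: sorted_words_def sorts_def sort_less_def permutes_inverses[OF s])
qed

text \<open>If the parity bits differ, comparing letters alone decides: from bit 1 to 0 equal halves
  are allowed, from 0 to 1 they are not. If the bits agree, equal halves mean a tie, allowed or not
  according to the bit and to whether \<sigma> descends at \<open>i\<close>.\<close>

lemma word_step_iff:
  fixes g g' :: nat
  assumes "\<sigma> permutes {1..n}" "i \<in> {1..<n}" "S \<subseteq> {1..n}"
  defines "x \<equiv> 2 * g + of_bool (i \<in> S)" and "x' \<equiv> 2 * g' + of_bool (Suc i \<in> S)"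
  shows "(x' < x \<or> x = x' \<and> (if even x then \<sigma> i < \<sigma> (Suc i) else \<sigma> (Suc i) < \<sigma> i))
    \<longleftrightarrow> g' \<le> g \<and> (i \<in> lift_des n \<sigma> S \<longrightarrow> g' < g)"
proof -
  have "i \<notin> desc n \<sigma> \<longleftrightarrow> \<sigma> i < \<sigma> (Suc i)" using assms by (intro not_desc_iff) auto
  moreover have "i \<in> desc n \<sigma> \<longleftrightarrow> \<sigma> (Suc i) < \<sigma> i" using assms(2) by (simp add: desc_def)
  ultimately show ?thesis using assms(2) unfolding x_def x'_def lift_des_def
    by (cases "i \<in> S"; cases "Suc i \<in> S"; cases "i \<in> desc n \<sigma>") auto
qed

text \<open>Complementing the halves of the letters gives an increasing chain, extended by the value
  0 at place 0 so that the bound on the first letter becomes a condition on step 0. For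
  \<open>N = 2 * k + 1\<close> an odd first letter has half below \<open>k\<close>, and this is the
  jump at \<open>0 \<in> lift_des n \<sigma> S\<close>. For \<open>N = 2 * k\<close> every half is
  below \<open>k\<close>, so a jump at 0 is always forced, whence \<open>Z = {0}\<close>.\<close>

lemma card_sorted_words_sign:
  assumes s: "\<sigma> permutes {1..n}" and n: "0 < n" and S: "S \<subseteq> {1..n}"
    and Z: "N = 2 * k + 1 \<and> Z = {} \<or> N = 2 * k \<and> Z = {0}"
  shows "card {f \<in> sorted_words n N \<sigma>. {i \<in> {1..n}. odd (f i)} = S} = card (step_chains n k (lift_des n \<sigma> S \<union> Z))"
proof -
  define up where "up f = (\<lambda>i\<in>{0..n}. if i = 0 then 0 else k - f i div 2)" for f :: "nat \<Rightarrow> nat"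
  define dn where "dn h = (\<lambda>i\<in>{1..n}. 2 * (k - h i) + of_bool (i \<in> S))" for h :: "nat \<Rightarrow> nat"
  let ?W = "{f \<in> sorted_words n N \<sigma>. {i \<in> {1..n}. odd (f i)} = S}"
  let ?C = "step_chains n k (lift_des n \<sigma> S \<union> Z)"
  have D0: "0 \<in> lift_des n \<sigma> S \<longleftrightarrow> 1 \<in> S" using n by (simp add: lift_des_def desc_def)
  have W: "f i = 2 * (f i div 2) + of_bool (i \<in> S)" "f i div 2 \<le> k" "f i < N"
    if "f \<in> ?W" "i \<in> {1..n}" for f i
  proof -
    have "odd (f i) \<longleftrightarrow> i \<in> S" using that by auto
    then show "f i = 2 * (f i div 2) + of_bool (i \<in> S)" by (cases "i \<in> S") auto
    show "f i < N" using that by (auto simp: sorted_words_def words_def)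
    then show "f i div 2 \<le> k" using Z by auto
  qed
  have C: "h i \<le> k" if "h \<in> ?C" "i \<in> {1..n}" for h i
    using that by (auto simp: step_chains_def)
  show ?thesis
  proof (rule bij_betw_same_card[of up], rule bij_betw_byWitness[where f' = dn])
    show "\<forall>f\<in>?W. dn (up f) = f"
    proof (intro ballI ext)
      fix f i assume f: "f \<in> ?W"
      show "dn (up f) i = f i"
      proof (cases "i \<in> {1..n}")
        case True
        then show ?thesis using W[OF f True] by (simp add: dn_def up_def)
      next
        case False
        have "f \<in> words n N" using f by (simp add: sorted_words_def)
        from words_undefined[OF this False] show ?thesis using False by (simp only: dn_def restrict_def if_False)
      qed
    qed
    show "\<forall>h\<in>?C. up (dn h) = h"
    proof (intro ballI ext)
      fix h i assume h: "h \<in> ?C"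
      have h0: "h 0 = 0" using h by (simp add: step_chains_def)
      have hu: "h i = undefined" if "i > n" using that h by (auto simp: step_chains_def PiE_def extensional_def)
      consider "i = 0" | "i \<in> {1..n}" | "i > n" by force
      then show "up (dn h) i = h i"
      proof cases
        case 2
        then show ?thesis using C[OF h 2] by (auto simp: up_def dn_def)
      qed (use h0 hu in \<open>auto simp: up_def\<close>)
    qed
    show "up ` ?W \<subseteq> ?C"
    proof (intro image_subsetI)
      fix f assume f: "f \<in> ?W"
      have "up f i \<le> up f (Suc i) \<and> (i \<in> lift_des n \<sigma> S \<union> Z \<longrightarrow> up f i < up f (Suc i))" if "i < n" for i
      proof (cases "i = 0")
        case True
        have 1: "1 \<in> {1..n}" using n by simp
        have "f 1 div 2 < k" if "0 \<in> lift_des n \<sigma> S \<union> Z"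
          using that W[OF f 1] Z unfolding D0[symmetric] by auto
        then show ?thesis using True n by (auto simp: up_def)
      next
        case False
        then have i: "i \<in> {1..<n}" "i \<in> {1..n}" "Suc i \<in> {1..n}" using that by auto
        have "f (Suc i) < f i \<or> f i = f (Suc i) \<and> (if even (f i) then \<sigma> i < \<sigma> (Suc i) else \<sigma> (Suc i) < \<sigma> i)"
          using f i by (simp add: sorted_words_def)
        then have "f (Suc i) div 2 \<le> f i div 2 \<and> (i \<in> lift_des n \<sigma> S \<longrightarrow> f (Suc i) div 2 < f i div 2)"
          using word_step_iff[OF s i(1) S, of "f (Suc i) div 2" "f i div 2"]
          unfolding W(1)[OF f i(2), symmetric] W(1)[OF f i(3), symmetric] by blast
        moreover have "i \<notin> Z" using False Z by auto
        ultimately show ?thesis using i W(2)[OF f i(2)] by (auto simp: up_def)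
      qed
      then show "up f \<in> ?C" by (auto simp: step_chains_def up_def)
    qed
    show "dn ` ?C \<subseteq> ?W"
    proof (intro image_subsetI)
      fix h assume h: "h \<in> ?C"
      have step: "h i \<le> h (Suc i)" "i \<in> lift_des n \<sigma> S \<union> Z \<Longrightarrow> h i < h (Suc i)" if "i < n" for i
        using h that by (auto simp: step_chains_def)
      have h0: "h 0 = 0" using h by (simp add: step_chains_def)
      have dstep: "dn h (Suc i) < dn h i \<or> dn h i = dn h (Suc i) \<and>
          (if even (dn h i) then \<sigma> i < \<sigma> (Suc i) else \<sigma> (Suc i) < \<sigma> i)" if "i \<in> {1..<n}" for i
      proof -
        have i: "i \<in> {1..n}" "Suc i \<in> {1..n}" using that by auto
        have "k - h (Suc i) \<le> k - h i \<and> (i \<in> lift_des n \<sigma> S \<longrightarrow> k - h (Suc i) < k - h i)"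
          using step[of i] that C[OF h i(2)] by auto
        then show ?thesis
          using word_step_iff[OF s that S, of "k - h (Suc i)" "k - h i"] i by (simp add: dn_def)
      qed
      \<comment> \<open>The letters weakly decrease, so the bound \<open>N\<close> has to be checked
        for the first one only.\<close>
      have first: "dn h 1 < N"
      proof -
        have "h 1 \<le> k" using C[OF h, of 1] n by simp
        moreover have "0 < h 1" if "1 \<in> S \<or> Z = {0}" using that step(2)[of 0] n D0 h0 by auto
        ultimately show ?thesis using Z n by (auto simp: dn_def)
      qed
      have "1 \<le> i \<Longrightarrow> i \<le> n \<Longrightarrow> dn h i < N" for i
      proof (induction i)
        case (Suc i)
        show ?case
        proof (cases "i = 0")
          case False
          then have "dn h (Suc i) \<le> dn h i" using dstep[of i] Suc.prems by auto
          then show ?thesis using Suc False by simp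
        qed (use first in simp)
      qed simp
      then have "dn h \<in> words n N" by (auto simp: words_def dn_def)
      moreover have "{i \<in> {1..n}. odd (dn h i)} = S" using S by (auto simp: dn_def)
      ultimately show "dn h \<in> ?W" using dstep by (simp add: sorted_words_def)
    qed
  qed
qed

lemma sort_count_eq_sum:
  assumes s: "\<sigma> permutes {1..n}" and n: "0 < n"
    and Z: "N = 2 * k + 1 \<and> Z = {} \<or> N = 2 * k \<and> Z = {0}"
  shows "sort_count n N \<sigma> = (\<Sum>S\<in>Pow {1..n}. (n + k - card (lift_des n \<sigma> S \<union> Z)) choose n)"
proof -
  have fin: "finite (sorted_words n N \<sigma>)"
    by (rule finite_subset[OF _ finite_words[of n N]]) (auto simp: sorted_words_def)
  have "sort_count n N \<sigma> = (\<Sum>f\<in>sorted_words n N \<sigma>. 1)" by (simp add: sort_count_eq[OF s])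
  also have "\<dots> = (\<Sum>S\<in>Pow {1..n}. \<Sum>f\<in>{f \<in> sorted_words n N \<sigma>. {i \<in> {1..n}. odd (f i)} = S}. 1)"
    by (rule sum.group[symmetric]) (auto simp: fin)
  also have "\<dots> = (\<Sum>S\<in>Pow {1..n}. (n + k - card (lift_des n \<sigma> S \<union> Z)) choose n)"
  proof (intro sum.cong refl)
    fix S assume S: "S \<in> Pow {1..n}"
    have "(lift_des n \<sigma> S \<union> Z) \<inter> {..<n} = lift_des n \<sigma> S \<union> Z"
      using Z n by (auto simp: lift_des_def)
    then show "(\<Sum>f\<in>{f \<in> sorted_words n N \<sigma>. {i \<in> {1..n}. odd (f i)} = S}. 1)
        = (n + k - card (lift_des n \<sigma> S \<union> Z)) choose n"
      using card_sorted_words_sign[OF s n _ Z, of S] S by (simp add: card_step_chains)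
  qed
  finally show ?thesis .
qed

section \<open>Polynomiality and idempotency over the rationals\<close>

text \<open>The binomial coefficient \<open>n + z - j\<close> over \<open>n\<close> as a polynomial
  in \<open>z\<close>; at \<open>z = k\<close> it counts the chains with \<open>j\<close> forced
  jumps.\<close>

definition binom_poly :: "nat \<Rightarrow> nat \<Rightarrow> rat poly" where
  "binom_poly n j = smult (1 / fact n) (\<Prod>i=0..<n. [:of_nat n - of_nat j - of_nat i, 1:])"

lemma poly_binom_poly: "poly (binom_poly n j) z = (of_nat n + z - of_nat j) gchoose n"
  by (simp add: binom_poly_def poly_prod gbinomial_prod_rev algebra_simps)

lemma poly_binom_poly_of_nat:
  assumes "j \<le> n"
  shows "poly (binom_poly n j) (of_nat k) = of_nat ((n + k - j) choose n)"
proof -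
  have "(of_nat n + of_nat k - of_nat j :: rat) = of_nat (n + k - j)"
    using assms by (simp add: of_nat_diff)
  then show ?thesis by (simp only: poly_binom_poly binomial_gbinomial)
qed

lemma binom_poly_pascal: "binom_poly (Suc n) j - binom_poly (Suc n) (Suc j) = binom_poly n j"
proof -
  have "poly (binom_poly (Suc n) j - binom_poly (Suc n) (Suc j)) z = poly (binom_poly n j) z" for z
    using gbinomial_Suc_Suc[of "of_nat n + z - of_nat j" n] by (simp add: poly_binom_poly algebra_simps)
  then show ?thesis by (intro poly_eq_poly_eq_iff[THEN iffD1] ext)
qed

text \<open>Both sides satisfy the same Pascal recursion in \<open>j\<close>. For
  \<open>j = 0\<close> they are the central binomial coefficient of \<open>2m\<close> divided by
  \<open>4^m\<close>, obtained by absorption.\<close>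

lemma poly_binom_poly_half: "poly (binom_poly (j + m) j) (- 1 / 2) = (-1) ^ j * e_abs_coeff j m"
proof (induction j arbitrary: m)
  case 0
  have "(of_nat m - 1 / 2) gchoose m = e_abs_coeff 0 m"
  proof (induction m)
    case (Suc m)
    define X Y M :: rat where "X = of_nat (dfact (2 * int m - 1))" and "Y = of_nat (dfact (2 * int m))"
      and "M = of_nat m"
    have Y: "Y \<noteq> 0" using dfact_pos[of "2 * int m"] by (simp add: Y_def)
    have M: "M + 1 \<noteq> 0" using of_nat_0_le_iff[of m, where 'a = rat] unfolding M_def by linarith
    have d: "dfact (2 * int (Suc m)) = (2 * m + 2) * dfact (2 * int m)"
      unfolding dfact_even_fact by (simp add: algebra_simps)
    have e: "e_abs_coeff 0 m = X / Y" "e_abs_coeff 0 (Suc m) = (2 * M + 1) * X / (2 * ((M + 1) * Y))"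
      unfolding e_abs_coeff_def dfact_odd_Suc add_0 d
      by (simp_all add: dfact_nonpos X_def Y_def M_def algebra_simps)
    have "(M + 1) * ((M + 1 / 2) gchoose Suc m) = (M + 1 / 2) * ((M - 1 / 2) gchoose m)"
      using gbinomial_absorption[of m "M + 1 / 2"] by (simp add: M_def algebra_simps)
    also have "\<dots> = (M + 1 / 2) * (X / Y)" using Suc e by (simp add: M_def)
    also have "\<dots> = (M + 1) * e_abs_coeff 0 (Suc m)"
      unfolding e using M Y by (simp add: divide_simps)
    finally have "(M + 1 / 2) gchoose Suc m = e_abs_coeff 0 (Suc m)" using M by simp
    moreover have "of_nat (Suc m) - 1 / 2 = M + 1 / 2" by (simp add: M_def)
    ultimately show ?case by (simp only:)
  qed (simp add: e_abs_coeff_def dfact_nonpos)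
  then show ?case by (simp add: poly_binom_poly)
next
  case (Suc j)
  have "poly (binom_poly (Suc j + m) (Suc j)) (- 1 / 2)
      = poly (binom_poly (j + Suc m) j) (- 1 / 2) - poly (binom_poly (j + m) j) (- 1 / 2)"
    unfolding binom_poly_pascal[of "j + m" j, symmetric] by simp
  then show ?case unfolding Suc by (simp add: e_abs_coeff_rec algebra_simps)
qed

lemma coeff_binom_poly: "coeff (binom_poly (Suc (j + m)) (Suc j)) 1 = (-1) ^ j * e0_abs_coeff j m"
proof (induction j arbitrary: m)
  case 0
  define Q :: "rat poly" where "Q = (\<Prod>i=0..<m. [:of_nat m - of_nat i, 1:])"
  have "poly Q 0 = fact m"
    using gbinomial_mult_fact'[of "of_nat m :: rat" m] by (simp add: Q_def poly_prod flip: binomial_gbinomial)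
  \<comment> \<open>The last factor of the product, \<open>i = m\<close>, is the variable itself, so
    the linear coefficient comes from the value of \<open>Q\<close> at 0.\<close>
  moreover have "binom_poly (Suc m) (Suc 0) = smult (1 / fact (Suc m)) (pCons 0 Q)"
    by (simp add: binom_poly_def Q_def mult.commute)
  ultimately show ?case by (simp add: e0_abs_coeff_def poly_0_coeff_0)
next
  case (Suc j)
  have "binom_poly (Suc (Suc j + m)) (Suc (Suc j))
      = binom_poly (Suc (j + Suc m)) (Suc j) - binom_poly (Suc (j + m)) (Suc j)"
    unfolding binom_poly_pascal[of "Suc (j + m)" "Suc j", symmetric] by simp
  then have "coeff (binom_poly (Suc (Suc j + m)) (Suc (Suc j))) 1
      = (-1) ^ j * e0_abs_coeff j (Suc m) - (-1) ^ j * e0_abs_coeff j m"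
    by (simp only: coeff_diff Suc)
  then show ?case using e0_abs_coeff_pascal[of j m] by (simp add: algebra_simps)
qed

section \<open>Counting polynomials and their product identities\<close>

lemma poly_eqI_of_nat:
  fixes p q :: "rat poly"
  assumes "\<And>k::nat. poly p (of_nat k) = poly q (of_nat k)"
  shows "p = q"
proof (rule ccontr)
  assume "p \<noteq> q"
  then have "finite {x. poly (p - q) x = 0}" by (intro poly_roots_finite) simp
  moreover have "range (of_nat :: nat \<Rightarrow> rat) \<subseteq> {x. poly (p - q) x = 0}" using assms by auto
  ultimately have "finite (range (of_nat :: nat \<Rightarrow> rat))" by (rule finite_subset[rotated])
  then show False using finite_imageD[of "of_nat :: nat \<Rightarrow> rat" UNIV] inj_of_nat by auto
qed

text \<open>The coefficient of \<sigma> as a polynomial in \<open>k\<close>: in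
  \<open>X_(2k+1)\<close> for \<open>Z = {}\<close> and in \<open>X_2k\<close> for
  \<open>Z = {0}\<close>.\<close>

definition count_poly :: "nat \<Rightarrow> nat set \<Rightarrow> (nat \<Rightarrow> nat) \<Rightarrow> rat poly" where
  "count_poly n Z \<sigma> = (\<Sum>S\<in>Pow {1..n}. binom_poly n (card (lift_des n \<sigma> S \<union> Z)))"

lemma poly_count_poly:
  assumes s: "\<sigma> permutes {1..n}" and n: "0 < n"
    and Z: "N = 2 * k + 1 \<and> Z = {} \<or> N = 2 * k \<and> Z = {0}"
  shows "poly (count_poly n Z \<sigma>) (of_nat k) = of_nat (sort_count n N \<sigma>)"
proof -
  have "card (lift_des n \<sigma> S \<union> Z) \<le> n" for S
  proof -
    have "card (lift_des n \<sigma> S \<union> Z) \<le> card {..<n}"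
      using Z n by (intro card_mono) (auto simp: lift_des_def)
    then show ?thesis by simp
  qed
  then show ?thesis
    by (simp add: sort_count_eq_sum[OF assms] count_poly_def poly_sum poly_binom_poly_of_nat)
qed

lemma permutes_inv_comp: "\<sigma> permutes A \<Longrightarrow> \<rho> permutes A \<Longrightarrow> inv' \<sigma> \<circ> \<rho> permutes A"
  by (intro permutes_compose permutes_inv)

lemma count_poly_mult_odd:
  assumes "\<rho> permutes {1..n}" "0 < n"
  shows "(\<Sum>\<sigma> | \<sigma> permutes {1..n}. poly (count_poly n {} \<sigma>) (of_nat k) * poly (count_poly n {} (inv' \<sigma> \<circ> \<rho>)) (of_nat l))
    = poly (count_poly n {} \<rho>) (of_nat (2 * k * l + k + l))"
proof -
  have "(2 * l + 1) * (2 * k + 1) = 2 * (2 * k * l + k + l) + 1" by (simp add: algebra_simps)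
  then have "poly (count_poly n {} \<rho>) (of_nat (2 * k * l + k + l))
      = of_nat (sort_count n ((2 * l + 1) * (2 * k + 1)) \<rho>)"
    by (intro poly_count_poly assms) simp
  also have "\<dots> = (\<Sum>\<sigma> | \<sigma> permutes {1..n}. of_nat (sort_count n (2 * k + 1) \<sigma>) * of_nat (sort_count n (2 * l + 1) (inv' \<sigma> \<circ> \<rho>)))"
    unfolding sort_count_mult[OF assms(1), symmetric] by simp
  also have "\<dots> = (\<Sum>\<sigma> | \<sigma> permutes {1..n}. poly (count_poly n {} \<sigma>) (of_nat k) * poly (count_poly n {} (inv' \<sigma> \<circ> \<rho>)) (of_nat l))"
    using assms
    by (intro sum.cong refl arg_cong2[where f = "(*)"] poly_count_poly[symmetric]) (auto intro: permutes_inv_comp)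
  finally show ?thesis by simp
qed

lemma count_poly_mult_even:
  assumes "\<rho> permutes {1..n}" "0 < n"
  shows "(\<Sum>\<sigma> | \<sigma> permutes {1..n}. poly (count_poly n {0} \<sigma>) (of_nat k) * poly (count_poly n {0} (inv' \<sigma> \<circ> \<rho>)) (of_nat l))
    = poly (count_poly n {0} \<rho>) (of_nat (2 * k * l))"
proof -
  have "(2 * l) * (2 * k) = 2 * (2 * k * l)" by (simp add: algebra_simps)
  then have "poly (count_poly n {0} \<rho>) (of_nat (2 * k * l)) = of_nat (sort_count n ((2 * l) * (2 * k)) \<rho>)"
    by (intro poly_count_poly assms) simp
  also have "\<dots> = (\<Sum>\<sigma> | \<sigma> permutes {1..n}. of_nat (sort_count n (2 * k) \<sigma>) * of_nat (sort_count n (2 * l) (inv' \<sigma> \<circ> \<rho>)))"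
    unfolding sort_count_mult[OF assms(1), symmetric] by simp
  also have "\<dots> = (\<Sum>\<sigma> | \<sigma> permutes {1..n}. poly (count_poly n {0} \<sigma>) (of_nat k) * poly (count_poly n {0} (inv' \<sigma> \<circ> \<rho>)) (of_nat l))"
    using assms
    by (intro sum.cong refl arg_cong2[where f = "(*)"] poly_count_poly[symmetric]) (auto intro: permutes_inv_comp)
  finally show ?thesis by simp
qed

text \<open>The value \<open>k = - 1 / 2\<close> corresponds formally to
  \<open>N = 2k + 1 = 0\<close>, and accordingly \<open>2kl + k + l\<close> equals
  \<open>- 1 / 2\<close> there for every \<open>l\<close>. So the element with coefficients
  \<open>c\<close> is unchanged by multiplication with each \<open>X_(2l+1)\<close>; this identity
  is polynomial in \<open>l\<close> and can be evaluated at \<open>- 1 / 2\<close> once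
  more.\<close>

lemma count_poly_half_idem:
  assumes "\<rho> permutes {1..n}" "0 < n"
  defines "c \<equiv> \<lambda>\<sigma>. poly (count_poly n {} \<sigma>) (- 1 / 2)"
  shows "(\<Sum>\<sigma> | \<sigma> permutes {1..n}. c \<sigma> * c (inv' \<sigma> \<circ> \<rho>)) = c \<rho>"
proof -
  let ?P = "{\<sigma>. \<sigma> permutes {1..n}}" and ?C = "count_poly n {}"
  have 1: "(\<Sum>\<sigma>\<in>?P. c \<sigma> * poly (?C (inv' \<sigma> \<circ> \<rho>)) (of_nat l)) = c \<rho>" for l
  proof -
    have "(\<Sum>\<sigma>\<in>?P. smult (poly (?C (inv' \<sigma> \<circ> \<rho>)) (of_nat l)) (?C \<sigma>)) = pcompose (?C \<rho>) [:of_nat l, 2 * of_nat l + 1:]"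
    proof (rule poly_eqI_of_nat)
      fix k
      have ev: "poly [:of_nat l, 2 * of_nat l + 1:] (of_nat k) = (of_nat (2 * k * l + k + l) :: rat)"
        by (simp add: algebra_simps)
      show "poly (\<Sum>\<sigma>\<in>?P. smult (poly (?C (inv' \<sigma> \<circ> \<rho>)) (of_nat l)) (?C \<sigma>)) (of_nat k)
          = poly (pcompose (?C \<rho>) [:of_nat l, 2 * of_nat l + 1:]) (of_nat k)"
        unfolding poly_pcompose ev count_poly_mult_odd[OF assms(1,2), symmetric] poly_sum
        by (simp add: mult.commute)
    qed
    note eq = this
    have ev: "poly [:of_nat l, 2 * of_nat l + 1:] (- 1 / 2) = (- 1 / 2 :: rat)"
      by (simp add: field_simps)
    have "(\<Sum>\<sigma>\<in>?P. c \<sigma> * poly (?C (inv' \<sigma> \<circ> \<rho>)) (of_nat l))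
        = poly (\<Sum>\<sigma>\<in>?P. smult (poly (?C (inv' \<sigma> \<circ> \<rho>)) (of_nat l)) (?C \<sigma>)) (- 1 / 2)"
      unfolding c_def by (simp only: poly_sum poly_smult mult.commute)
    also have "\<dots> = c \<rho>" unfolding eq poly_pcompose ev c_def ..
    finally show ?thesis .
  qed
  have "(\<Sum>\<sigma>\<in>?P. smult (c \<sigma>) (?C (inv' \<sigma> \<circ> \<rho>))) = [:c \<rho>:]"
    by (rule poly_eqI_of_nat) (simp only: poly_sum poly_smult 1, simp)
  from arg_cong[OF this, of "\<lambda>p. poly p (- 1 / 2)"] show ?thesis
    by (simp add: poly_sum c_def)
qed

text \<open>Linear terms are compared first in \<open>k\<close> and then in \<open>l\<close>. On the
  right, the coefficient of \<open>k l\<close> in a polynomial evaluated at \<open>2 k l\<close> is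
  twice its linear coefficient.\<close>

lemma count_poly_linear_quasi_idem:
  assumes "\<rho> permutes {1..n}" "0 < n"
  defines "c \<equiv> \<lambda>\<sigma>. coeff (count_poly n {0} \<sigma>) 1"
  shows "(\<Sum>\<sigma> | \<sigma> permutes {1..n}. c \<sigma> * c (inv' \<sigma> \<circ> \<rho>)) = 2 * c \<rho>"
proof -
  let ?P = "{\<sigma>. \<sigma> permutes {1..n}}" and ?C = "count_poly n {0}"
  have 1: "(\<Sum>\<sigma>\<in>?P. c \<sigma> * poly (?C (inv' \<sigma> \<circ> \<rho>)) (of_nat l)) = 2 * c \<rho> * of_nat l" for l
  proof -
    have "(\<Sum>\<sigma>\<in>?P. smult (poly (?C (inv' \<sigma> \<circ> \<rho>)) (of_nat l)) (?C \<sigma>)) = pcompose (?C \<rho>) [:0, 2 * of_nat l:]"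
    proof (rule poly_eqI_of_nat)
      fix k
      have ev: "poly [:0, 2 * of_nat l:] (of_nat k) = (of_nat (2 * k * l) :: rat)" by simp
      show "poly (\<Sum>\<sigma>\<in>?P. smult (poly (?C (inv' \<sigma> \<circ> \<rho>)) (of_nat l)) (?C \<sigma>)) (of_nat k)
          = poly (pcompose (?C \<rho>) [:0, 2 * of_nat l:]) (of_nat k)"
        unfolding poly_pcompose ev count_poly_mult_even[OF assms(1,2), symmetric] poly_sum
        by (simp add: mult.commute)
    qed
    from arg_cong[OF this, of "\<lambda>p. coeff p 1"] show ?thesis
      by (simp add: coeff_sum coeff_pcompose_linear c_def mult.commute)
  qed
  have "(\<Sum>\<sigma>\<in>?P. smult (c \<sigma>) (?C (inv' \<sigma> \<circ> \<rho>))) = [:0, 2 * c \<rho>:]"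
    by (rule poly_eqI_of_nat) (simp only: poly_sum poly_smult 1, simp)
  from arg_cong[OF this, of "\<lambda>p. coeff p 1"] show ?thesis
    by (simp add: coeff_sum c_def)
qed

lemma poly_count_poly_half:
  assumes "\<sigma> permutes {1..n}"
  shows "poly (count_poly n {} \<sigma>) (- 1 / 2) = (\<Sum>S\<in>Pow {1..n}. e_coeff n (card (lift_des n \<sigma> S)))"
proof -
  have "poly (binom_poly n j) (- 1 / 2) = e_coeff n j" if "j \<le> n" for j
    using poly_binom_poly_half[of j "n - j"] that by (simp add: e_coeff_eq)
  then show ?thesis by (simp add: count_poly_def poly_sum card_lift_des_le)
qed

lemma coeff_count_poly:
  assumes "\<sigma> permutes {1..n}" "0 < n"
  shows "coeff (count_poly n {0} \<sigma>) 1 = (\<Sum>S\<in>Pow {1..n}. e0_coeff n (Suc (card (lift_des n \<sigma> S - {0}))))"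
proof -
  have "coeff (binom_poly n (card (lift_des n \<sigma> S \<union> {0}))) 1 = e0_coeff n (Suc (card (lift_des n \<sigma> S - {0})))" for S
  proof -
    define d where "d = card (lift_des n \<sigma> S - {0})"
    have fin: "finite (lift_des n \<sigma> S)" by (simp add: lift_des_def)
    have "lift_des n \<sigma> S \<union> {0} = insert 0 (lift_des n \<sigma> S - {0})" by auto
    moreover have "card (insert 0 (lift_des n \<sigma> S - {0})) = Suc d"
      unfolding d_def using fin by (intro card_insert_disjoint) auto
    ultimately have "card (lift_des n \<sigma> S \<union> {0}) = Suc d" by (simp only:)
    moreover have "d < n" using card_lift_des_minus_less[OF assms(2)] by (simp add: d_def)
    ultimately show ?thesis
      using coeff_binom_poly[of d "n - Suc d"] e0_coeff_eq[of "Suc d" n] by (simp add: d_def[symmetric])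
  qed
  then show ?thesis by (simp add: count_poly_def coeff_sum)
qed

section \<open>Idempotency of the peak coefficients over the rationals\<close>

lemma rho_coeff_idem:
  assumes "\<rho> permutes {1..n}" "even n" "0 < n"
  defines "c \<equiv> \<lambda>\<sigma>. rho_coeff n (card (Peak n \<sigma>))"
  shows "(\<Sum>\<sigma> | \<sigma> permutes {1..n}. c \<sigma> * c (inv' \<sigma> \<circ> \<rho>)) = c \<rho>"
proof -
  have "poly (count_poly n {} \<sigma>) (- 1 / 2) = c \<sigma>" if "\<sigma> permutes {1..n}" for \<sigma>
    using poly_count_poly_half[OF that] sum_e_coeff[OF that] assms(2) by (simp add: c_def)
  then show ?thesis
    using count_poly_half_idem[OF assms(1,3)] assms(1) by (simp add: permutes_inv_comp)
qed

lemma rho0_coeff_idem: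
  assumes "\<rho> permutes {1..n}" "odd n"
  defines "c \<equiv> \<lambda>\<sigma>. rho0_coeff n (Suc (card (Peak n \<sigma> - {1})))"
  shows "(\<Sum>\<sigma> | \<sigma> permutes {1..n}. c \<sigma> * c (inv' \<sigma> \<circ> \<rho>)) = c \<rho>"
proof -
  have n: "0 < n" using assms(2) by (rule odd_pos)
  have "coeff (count_poly n {0} \<sigma>) 1 = 2 * c \<sigma>" if "\<sigma> permutes {1..n}" for \<sigma>
    using coeff_count_poly[OF that n] sum_e0_coeff[OF that n] assms(2) by (simp add: c_def)
  then have "(\<Sum>\<sigma> | \<sigma> permutes {1..n}. (2 * c \<sigma>) * (2 * c (inv' \<sigma> \<circ> \<rho>))) = 2 * (2 * c \<rho>)"
    using count_poly_linear_quasi_idem[OF assms(1) n] assms(1) by (simp add: permutes_inv_comp)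
  then have "4 * (\<Sum>\<sigma> | \<sigma> permutes {1..n}. c \<sigma> * c (inv' \<sigma> \<circ> \<rho>)) = 4 * c \<rho>"
    by (simp add: sum_distrib_left algebra_simps)
  then show ?thesis by simp
qed

section \<open>Reduction of rational coefficients to a field\<close>

text \<open>Any fraction whose denominator is nonzero in the field may be used, reduced or not: the
  reduced denominator divides it and so is nonzero as well.\<close>

lemma rat_to_field_divide:
  assumes "(of_int q :: 'k::field) \<noteq> 0"
  shows "rat_makes_sense TYPE('k) (of_int p / of_int q)"
    and "rat_to_field (of_int p / of_int q) = (of_int p / of_int q :: 'k)"
proof -
  define r :: rat where "r = of_int p / of_int q"
  obtain a b where ab: "quotient_of r = (a, b)" by (cases "quotient_of r")
  have b: "b > 0" "coprime a b" "r = of_int a / of_int b"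
    using ab quotient_of_denom_pos quotient_of_coprime quotient_of_div by auto
  have "q \<noteq> 0" using assms by auto
  then have "(of_int (a * q) :: rat) = of_int (p * b)" using b by (simp add: r_def field_simps)
  then have eq: "a * q = p * b" by (simp only: of_int_eq_iff)
  then have "b dvd a * q" by simp
  then have "b dvd q" using b(2) by (simp add: coprime_commute coprime_dvd_mult_right_iff)
  then obtain c where "q = b * c" ..
  then have nz: "(of_int b :: 'k) \<noteq> 0" using assms by auto
  have "(of_int a * of_int q :: 'k) = of_int p * of_int b"
    using arg_cong[OF eq, of "of_int :: int \<Rightarrow> 'k"] by simp
  then show "rat_to_field (of_int p / of_int q) = (of_int p / of_int q :: 'k)"
    using nz assms unfolding r_def[symmetric] rat_to_field_def ab by (simp add: field_simps)
  show "rat_makes_sense TYPE('k) (of_int p / of_int q)"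
    using nz unfolding r_def[symmetric] rat_makes_sense_def ab by simp
qed

lemma rat_makes_senseE:
  assumes "rat_makes_sense TYPE('k::field) r"
  obtains p q where "r = of_int p / of_int q" "(of_int q :: 'k) \<noteq> 0"
  using assms quotient_of_div[of r] by (cases "quotient_of r") (auto simp: rat_makes_sense_def)

lemma rat_to_field_of_int:
  shows "rat_makes_sense TYPE('k::field) (of_int p)" and "rat_to_field (of_int p) = (of_int p :: 'k)"
  using rat_to_field_divide[of 1 p, where 'k = 'k] by simp_all

lemma rat_to_field_add:
  assumes "rat_makes_sense TYPE('k::field) r" "rat_makes_sense TYPE('k) s"
  shows "rat_makes_sense TYPE('k) (r + s)"
    and "rat_to_field (r + s) = (rat_to_field r + rat_to_field s :: 'k)"
proof -
  obtain p q where r: "r = of_int p / of_int q" "(of_int q :: 'k) \<noteq> 0"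
    using assms(1) by (rule rat_makes_senseE)
  obtain u v where s: "s = of_int u / of_int v" "(of_int v :: 'k) \<noteq> 0"
    using assms(2) by (rule rat_makes_senseE)
  have nz: "(of_int (q * v) :: 'k) \<noteq> 0" using r s by simp
  have "q \<noteq> 0" "v \<noteq> 0" using r s by auto
  then have eq: "r + s = of_int (p * v + u * q) / of_int (q * v)"
    unfolding r(1) s(1) by (simp add: add_frac_eq)
  show "rat_makes_sense TYPE('k) (r + s)" unfolding eq by (rule rat_to_field_divide(1)[OF nz])
  show "rat_to_field (r + s) = (rat_to_field r + rat_to_field s :: 'k)"
    unfolding eq rat_to_field_divide(2)[OF nz] unfolding r(1) s(1)
    using r(2) s(2) by (simp add: rat_to_field_divide add_frac_eq)
qed

lemma rat_to_field_mult:
  assumes "rat_makes_sense TYPE('k::field) r" "rat_makes_sense TYPE('k) s"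
  shows "rat_makes_sense TYPE('k) (r * s)"
    and "rat_to_field (r * s) = (rat_to_field r * rat_to_field s :: 'k)"
proof -
  obtain p q where r: "r = of_int p / of_int q" "(of_int q :: 'k) \<noteq> 0"
    using assms(1) by (rule rat_makes_senseE)
  obtain u v where s: "s = of_int u / of_int v" "(of_int v :: 'k) \<noteq> 0"
    using assms(2) by (rule rat_makes_senseE)
  have nz: "(of_int (q * v) :: 'k) \<noteq> 0" using r s by simp
  have eq: "r * s = of_int (p * u) / of_int (q * v)" unfolding r(1) s(1) by simp
  show "rat_makes_sense TYPE('k) (r * s)" unfolding eq by (rule rat_to_field_divide(1)[OF nz])
  show "rat_to_field (r * s) = (rat_to_field r * rat_to_field s :: 'k)"
    unfolding eq rat_to_field_divide(2)[OF nz] unfolding r(1) s(1)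
    using r(2) s(2) by (simp add: rat_to_field_divide)
qed

lemma rat_to_field_sum:
  assumes "\<And>x. x \<in> A \<Longrightarrow> rat_makes_sense TYPE('k::field) (f x)"
  shows "rat_makes_sense TYPE('k) (sum f A)"
    and "rat_to_field (sum f A) = (\<Sum>x\<in>A. rat_to_field (f x) :: 'k)"
proof -
  have "rat_makes_sense TYPE('k) (sum f A) \<and> rat_to_field (sum f A) = (\<Sum>x\<in>A. rat_to_field (f x) :: 'k)"
    using assms
  proof (induction A rule: infinite_finite_induct)
    case (insert x A)
    then show ?case by (simp add: rat_to_field_add)
  qed (use rat_to_field_of_int[of 0, where 'k = 'k] in simp_all)
  then show "rat_makes_sense TYPE('k) (sum f A)"
    and "rat_to_field (sum f A) = (\<Sum>x\<in>A. rat_to_field (f x) :: 'k)" by simp_all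
qed

section \<open>Coefficients in the group algebra\<close>

lemma lookup_ga_scale: "Poly_Mapping.lookup (ga_scale c f) x = c * Poly_Mapping.lookup f x"
  by (simp add: ga_scale_def Poly_Mapping.map.rep_eq when_def)

lemma lookup_ga_sum: "finite A \<Longrightarrow> Poly_Mapping.lookup (ga_sum A) x = of_bool (x \<in> A)"
  by (simp add: ga_sum_def lookup_sum lookup_single when_def)

text \<open>The levels of the statistic \<open>d\<close> are disjoint, so at most one summand
  contributes at \<open>x\<close>.\<close>

lemma lookup_level_sum:
  assumes "finite X" "finite J" "\<And>j. j \<in> J \<Longrightarrow> y j = ga_sum {x \<in> X. d x = j}"
  shows "Poly_Mapping.lookup (\<Sum>j\<in>J. ga_scale (c j) (y j)) x = (if x \<in> X \<and> d x \<in> J then c (d x) else 0)"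
proof -
  have "Poly_Mapping.lookup (\<Sum>j\<in>J. ga_scale (c j) (y j)) x = (\<Sum>j\<in>J. if d x = j then if x \<in> X then c j else 0 else 0)"
    unfolding lookup_sum using assms by (intro sum.cong refl) (auto simp: lookup_ga_scale lookup_ga_sum)
  then show ?thesis using assms(2) by (simp add: sum.delta')
qed

lemma finite_signed_perms: "finite (signed_perms n)"
  by (rule finite_subset[OF _ finite_permutations[of "{- int n..int n} - {0}"]]) (auto simp: signed_perms_def)

lemma finite_sym_group: "finite (carrier (sym_group n))"
  by (simp add: sym_group_def finite_permutations)

text \<open>The fibre over a permutation consists of its signed lifts and is summed over the sets
  \<open>S\<close> of negative positions; over any other \<sigma> it is empty.\<close>

lemma lookup_phi:
  fixes f :: "(int \<Rightarrow> int) \<Rightarrow>\<^sub>0 'k::field"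
  assumes "\<And>\<tau>. Poly_Mapping.lookup f \<tau> = (if \<tau> \<in> signed_perms n then c (Des n \<tau>) else 0)"
  shows "Poly_Mapping.lookup (phi f) \<sigma>
    = (if \<sigma> permutes {1..n} then \<Sum>S\<in>Pow {1..n}. c (lift_des n \<sigma> S) else 0)"
proof -
  have keys: "Poly_Mapping.keys f \<subseteq> signed_perms n" by (auto simp: in_keys_iff assms split: if_splits)
  have "Poly_Mapping.lookup (phi f) \<sigma>
      = (\<Sum>\<tau>\<in>Poly_Mapping.keys f. if forget_signs \<tau> = \<sigma> then Poly_Mapping.lookup f \<tau> else 0)"
    by (simp add: phi_def ga_lin_ext_def lookup_sum lookup_single when_def)
  also have "\<dots> = (\<Sum>\<tau>\<in>signed_perms n. if forget_signs \<tau> = \<sigma> then Poly_Mapping.lookup f \<tau> else 0)"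
    using keys by (intro sum.mono_neutral_left finite_signed_perms) (auto simp: in_keys_iff)
  also have "\<dots> = (\<Sum>\<tau>\<in>{\<tau> \<in> signed_perms n. forget_signs \<tau> = \<sigma>}. c (Des n \<tau>))"
    by (subst sum.inter_filter[OF finite_signed_perms]) (auto intro!: sum.cong simp: assms)
  also have "\<dots> = (if \<sigma> permutes {1..n} then \<Sum>S\<in>Pow {1..n}. c (lift_des n \<sigma> S) else 0)"
  proof (cases "\<sigma> permutes {1..n}")
    case True
    have "(\<Sum>S\<in>Pow {1..n}. c (Des n (signed_lift \<sigma> S)))
        = (\<Sum>\<tau>\<in>{\<tau> \<in> signed_perms n. forget_signs \<tau> = \<sigma>}. c (Des n \<tau>))"
      by (rule sum.reindex_bij_betw[OF bij_betw_signed_lift[OF True]])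
    moreover have "(\<Sum>S\<in>Pow {1..n}. c (Des n (signed_lift \<sigma> S))) = (\<Sum>S\<in>Pow {1..n}. c (lift_des n \<sigma> S))"
      using Des_signed_lift[OF True] by (intro sum.cong) auto
    ultimately show ?thesis using True by (simp only: if_True)
  next
    case False
    then have "{\<tau> \<in> signed_perms n. forget_signs \<tau> = \<sigma>} = {}" using forget_signs_permutes by blast
    then show ?thesis using False by (simp only: if_False sum.empty)
  qed
  finally show ?thesis .
qed

lemma lookup_ga_mult_sym_group:
  fixes f g :: "(nat \<Rightarrow> nat) \<Rightarrow>\<^sub>0 'k::field"
  assumes "Poly_Mapping.keys f \<subseteq> {\<sigma>. \<sigma> permutes {1..n}}"
  shows "Poly_Mapping.lookup (ga_mult (sym_group n) f g) \<rho>
    = (\<Sum>\<sigma> | \<sigma> permutes {1..n}. Poly_Mapping.lookup f \<sigma> * Poly_Mapping.lookup g (inv' \<sigma> \<circ> \<rho>))"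
proof -
  let ?P = "{\<sigma>. \<sigma> permutes {1..n}}"
  have "Poly_Mapping.lookup (ga_mult (sym_group n) f g) \<rho>
      = (\<Sum>\<sigma>\<in>Poly_Mapping.keys f. \<Sum>\<tau>\<in>Poly_Mapping.keys g.
           if \<sigma> \<circ> \<tau> = \<rho> then Poly_Mapping.lookup f \<sigma> * Poly_Mapping.lookup g \<tau> else 0)"
    by (simp add: ga_mult_def sym_group_mult lookup_sum lookup_single when_def)
  also have "\<dots> = (\<Sum>\<sigma>\<in>Poly_Mapping.keys f. Poly_Mapping.lookup f \<sigma> * Poly_Mapping.lookup g (inv' \<sigma> \<circ> \<rho>))"
  proof (intro sum.cong refl)
    fix \<sigma> assume "\<sigma> \<in> Poly_Mapping.keys f"
    then have s: "\<sigma> permutes {1..n}" using assms by blast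
    have *: "\<sigma> \<circ> \<tau> = \<rho> \<longleftrightarrow> \<tau> = inv' \<sigma> \<circ> \<rho>" for \<tau>
      using permutes_inv_o[OF s] by (metis comp_assoc comp_id id_comp)
    show "(\<Sum>\<tau>\<in>Poly_Mapping.keys g. if \<sigma> \<circ> \<tau> = \<rho> then Poly_Mapping.lookup f \<sigma> * Poly_Mapping.lookup g \<tau> else 0)
        = Poly_Mapping.lookup f \<sigma> * Poly_Mapping.lookup g (inv' \<sigma> \<circ> \<rho>)"
      unfolding * by (simp add: sum.delta in_keys_iff)
  qed
  also have "\<dots> = (\<Sum>\<sigma>\<in>?P. Poly_Mapping.lookup f \<sigma> * Poly_Mapping.lookup g (inv' \<sigma> \<circ> \<rho>))"
    using assms by (intro sum.mono_neutral_left) (auto simp: finite_permutations in_keys_iff)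
  finally show ?thesis .
qed

text \<open>\<open>rat_to_field\<close> respects sums and products of rationals that make sense, so
  the rational convolution identity descends to the field.\<close>

lemma ga_idempotent_sym_groupI:
  fixes f :: "(nat \<Rightarrow> nat) \<Rightarrow>\<^sub>0 'k::field" and c :: "(nat \<Rightarrow> nat) \<Rightarrow> rat"
  assumes f: "\<And>\<sigma>. Poly_Mapping.lookup f \<sigma> = (if \<sigma> permutes {1..n} then rat_to_field (c \<sigma>) else 0)"
    and c: "\<And>\<sigma>. \<sigma> permutes {1..n} \<Longrightarrow> rat_makes_sense TYPE('k) (c \<sigma>)"
    and idem: "\<And>\<rho>. \<rho> permutes {1..n} \<Longrightarrow> (\<Sum>\<sigma> | \<sigma> permutes {1..n}. c \<sigma> * c (inv' \<sigma> \<circ> \<rho>)) = c \<rho>"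
  shows "ga_idempotent (sym_group n) f"
  unfolding ga_idempotent_def
proof (rule poly_mapping_eqI)
  fix \<rho>
  let ?P = "{\<sigma>. \<sigma> permutes {1..n}}"
  have keys: "Poly_Mapping.keys f \<subseteq> ?P" by (auto simp: in_keys_iff f split: if_splits)
  note l = lookup_ga_mult_sym_group[OF keys, of f \<rho>]
  show "Poly_Mapping.lookup (ga_mult (sym_group n) f f) \<rho> = Poly_Mapping.lookup f \<rho>"
  proof (cases "\<rho> permutes {1..n}")
    case True
    have s: "rat_makes_sense TYPE('k) (c \<sigma> * c (inv' \<sigma> \<circ> \<rho>))"
      and m: "rat_to_field (c \<sigma> * c (inv' \<sigma> \<circ> \<rho>)) = (rat_to_field (c \<sigma>) * rat_to_field (c (inv' \<sigma> \<circ> \<rho>)) :: 'k)"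
      if "\<sigma> \<in> ?P" for \<sigma>
      using that True by (auto intro!: rat_to_field_mult c permutes_inv_comp)
    have "Poly_Mapping.lookup (ga_mult (sym_group n) f f) \<rho>
        = (\<Sum>\<sigma>\<in>?P. rat_to_field (c \<sigma> * c (inv' \<sigma> \<circ> \<rho>)))"
      unfolding l using True by (intro sum.cong refl) (simp add: f m[simplified] permutes_inv_comp)
    also have "\<dots> = rat_to_field (\<Sum>\<sigma>\<in>?P. c \<sigma> * c (inv' \<sigma> \<circ> \<rho>))"
      by (rule rat_to_field_sum(2)[OF s, symmetric])
    also have "\<dots> = Poly_Mapping.lookup f \<rho>" using True by (simp only: idem f if_True)
    finally show ?thesis .
  next
    case False
    have "\<not> inv' \<sigma> \<circ> \<rho> permutes {1..n}" if s: "\<sigma> permutes {1..n}" for \<sigma>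
    proof
      assume "inv' \<sigma> \<circ> \<rho> permutes {1..n}"
      then have "\<sigma> \<circ> (inv' \<sigma> \<circ> \<rho>) permutes {1..n}" using s by (rule permutes_compose)
      then show False using False permutes_inv_o[OF s] by (simp add: comp_assoc[symmetric])
    qed
    then show ?thesis unfolding l using False by (simp add: f)
  qed
qed

lemma lookup_e_elt:
  "Poly_Mapping.lookup (e_elt n :: (int \<Rightarrow> int) \<Rightarrow>\<^sub>0 'k::field) \<tau>
    = (if \<tau> \<in> signed_perms n then rat_to_field (e_coeff n (card (Des n \<tau>))) else 0)"
proof -
  have "card (Des n \<tau>) \<le> card {0..<n}" by (rule card_mono) (auto simp: Des_def)
  moreover have "Poly_Mapping.lookup (e_elt n :: (int \<Rightarrow> int) \<Rightarrow>\<^sub>0 'k) \<tau>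
    = (if \<tau> \<in> signed_perms n \<and> card (Des n \<tau>) \<in> {0..n} then rat_to_field (e_coeff n (card (Des n \<tau>))) else 0)"
    unfolding e_elt_def by (rule lookup_level_sum) (auto simp: y_elt_def finite_signed_perms)
  ultimately show ?thesis by simp
qed

text \<open>The index \<open>j\<close> starts at 1, so the truncated \<open>j - 1\<close> is exact
  and level \<open>j\<close> is the value \<open>j\<close> of the statistic with
  \<open>Suc\<close>.\<close>

lemma lookup_e0_elt:
  assumes "0 < n"
  shows "Poly_Mapping.lookup (e0_elt n :: (int \<Rightarrow> int) \<Rightarrow>\<^sub>0 'k::field) \<tau>
    = (if \<tau> \<in> signed_perms n then rat_to_field (e0_coeff n (Suc (card (Des n \<tau> - {0})))) else 0)"
proof -
  have "card (Des n \<tau> - {0}) \<le> card {1..<n}" by (rule card_mono) (auto simp: Des_def)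
  then have "Suc (card (Des n \<tau> - {0})) \<in> {1..n}" using assms by auto
  moreover have "Poly_Mapping.lookup (e0_elt n :: (int \<Rightarrow> int) \<Rightarrow>\<^sub>0 'k) \<tau>
    = (if \<tau> \<in> signed_perms n \<and> Suc (card (Des n \<tau> - {0})) \<in> {1..n}
       then rat_to_field (e0_coeff n (Suc (card (Des n \<tau> - {0})))) else 0)"
    unfolding e0_elt_def
    by (rule lookup_level_sum) (auto simp: y0_elt_def finite_signed_perms intro!: arg_cong[where f = ga_sum])
  ultimately show ?thesis by simp
qed

lemma lookup_rho_elt:
  "Poly_Mapping.lookup (rho_elt n :: (nat \<Rightarrow> nat) \<Rightarrow>\<^sub>0 'k::field) \<sigma>
    = (if \<sigma> permutes {1..n} then rat_to_field (rho_coeff n (card (Peak n \<sigma>))) else 0)"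
proof -
  have "Poly_Mapping.lookup (rho_elt n :: (nat \<Rightarrow> nat) \<Rightarrow>\<^sub>0 'k) \<sigma>
    = (if \<sigma> \<in> carrier (sym_group n) \<and> card (Peak n \<sigma>) \<in> {0..n div 2}
       then rat_to_field (rho_coeff n (card (Peak n \<sigma>))) else 0)"
    unfolding rho_elt_def by (rule lookup_level_sum) (auto simp: p_elt_def finite_sym_group)
  then show ?thesis using card_Peak_le[of \<sigma> n] by (auto simp: sym_group_carrier)
qed

lemma lookup_rho0_elt:
  assumes "0 < n"
  shows "Poly_Mapping.lookup (rho0_elt n :: (nat \<Rightarrow> nat) \<Rightarrow>\<^sub>0 'k::field) \<sigma>
    = (if \<sigma> permutes {1..n} then rat_to_field (rho0_coeff n (Suc (card (Peak n \<sigma> - {1})))) else 0)"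
proof -
  have "Poly_Mapping.lookup (rho0_elt n :: (nat \<Rightarrow> nat) \<Rightarrow>\<^sub>0 'k) \<sigma>
    = (if \<sigma> \<in> carrier (sym_group n) \<and> Suc (card (Peak n \<sigma> - {1})) \<in> {1..(n + 1) div 2}
       then rat_to_field (rho0_coeff n (Suc (card (Peak n \<sigma> - {1})))) else 0)"
    unfolding rho0_elt_def
    by (rule lookup_level_sum) (auto simp: p0_elt_def finite_sym_group intro!: arg_cong[where f = ga_sum])
  then show ?thesis using card_Peak_minus_le[of \<sigma> n] assms by (auto simp: sym_group_carrier)
qed

section \<open>The images of the idempotents\<close>

lemma phi_e_elt:
  assumes "CHAR('k::field) \<noteq> 2"
  shows "phi (e_elt n :: (int \<Rightarrow> int) \<Rightarrow>\<^sub>0 'k) = (if even n then rho_elt n else 0)"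
proof (rule poly_mapping_eqI)
  fix \<sigma>
  have l: "Poly_Mapping.lookup (phi (e_elt n :: (int \<Rightarrow> int) \<Rightarrow>\<^sub>0 'k)) \<sigma>
      = (if \<sigma> permutes {1..n} then \<Sum>S\<in>Pow {1..n}. rat_to_field (e_coeff n (card (lift_des n \<sigma> S))) else 0)"
    by (rule lookup_phi) (rule lookup_e_elt)
  show "Poly_Mapping.lookup (phi (e_elt n :: (int \<Rightarrow> int) \<Rightarrow>\<^sub>0 'k)) \<sigma>
      = Poly_Mapping.lookup (if even n then rho_elt n else 0) \<sigma>"
  proof (cases "\<sigma> permutes {1..n}")
    case True
    have "(\<Sum>S\<in>Pow {1..n}. rat_to_field (e_coeff n (card (lift_des n \<sigma> S))) :: 'k)
        = rat_to_field (\<Sum>S\<in>Pow {1..n}. e_coeff n (card (lift_des n \<sigma> S)))"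
      by (rule rat_to_field_sum(2)[symmetric]) (rule e_coeff_makes_sense[OF assms card_lift_des_le])
    also have "\<dots> = Poly_Mapping.lookup (if even n then rho_elt n else 0) \<sigma>"
      unfolding sum_e_coeff[OF True]
      using True rat_to_field_of_int(2)[of 0, where 'k = 'k] by (simp add: lookup_rho_elt)
    finally show ?thesis using True l by simp
  next
    case False
    then show ?thesis using l by (simp add: lookup_rho_elt)
  qed
qed

lemma phi_e0_elt:
  assumes "CHAR('k::field) \<noteq> 2" "0 < n" "\<forall>j\<in>{1..n}. rat_makes_sense TYPE('k) (e0_coeff n j)"
  shows "phi (e0_elt n :: (int \<Rightarrow> int) \<Rightarrow>\<^sub>0 'k) = (if even n then 0 else ga_scale 2 (rho0_elt n))"
proof (rule poly_mapping_eqI)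
  fix \<sigma>
  have l: "Poly_Mapping.lookup (phi (e0_elt n :: (int \<Rightarrow> int) \<Rightarrow>\<^sub>0 'k)) \<sigma>
      = (if \<sigma> permutes {1..n}
         then \<Sum>S\<in>Pow {1..n}. rat_to_field (e0_coeff n (Suc (card (lift_des n \<sigma> S - {0})))) else 0)"
    by (rule lookup_phi) (rule lookup_e0_elt[OF assms(2)])
  show "Poly_Mapping.lookup (phi (e0_elt n :: (int \<Rightarrow> int) \<Rightarrow>\<^sub>0 'k)) \<sigma>
      = Poly_Mapping.lookup (if even n then 0 else ga_scale 2 (rho0_elt n)) \<sigma>"
  proof (cases "\<sigma> permutes {1..n}")
    case True
    define r where "r = rho0_coeff n (Suc (card (Peak n \<sigma> - {1})))"
    have s: "rat_makes_sense TYPE('k) (e0_coeff n (Suc (card (lift_des n \<sigma> S - {0}))))" for S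
      using assms(3) card_lift_des_minus_less[OF assms(2), of \<sigma> S] by auto
    have eq: "(\<Sum>S\<in>Pow {1..n}. rat_to_field (e0_coeff n (Suc (card (lift_des n \<sigma> S - {0})))) :: 'k)
        = rat_to_field (if even n then 0 else 2 * r)"
      unfolding r_def sum_e0_coeff[OF True assms(2), symmetric] by (rule rat_to_field_sum(2)[symmetric]) (rule s)
    \<comment> \<open>The hypothesis concerns \<open>e0_coeff\<close> only. It makes
      \<open>2 * r\<close> meaningful as a sum of such coefficients, and \<open>1 / 2\<close> makes
      sense because the characteristic is not 2; hence \<open>r\<close> itself makes sense.\<close>
    have "rat_to_field (2 * r) = (2 * rat_to_field r :: 'k)" if "odd n"
    proof -
      have "rat_makes_sense TYPE('k) (\<Sum>S\<in>Pow {1..n}. e0_coeff n (Suc (card (lift_des n \<sigma> S - {0}))))"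
        by (rule rat_to_field_sum(1)) (rule s)
      then have "rat_makes_sense TYPE('k) (2 * r)"
        using that by (simp only: sum_e0_coeff[OF True assms(2)] r_def if_False)
      moreover have "rat_makes_sense TYPE('k) (1 / 2)"
        by (rule rat_makes_sense_dyadic[OF assms(1), of _ 1]) simp
      ultimately have "rat_makes_sense TYPE('k) (1 / 2 * (2 * r))" by (rule rat_to_field_mult(1)[rotated])
      then have "rat_makes_sense TYPE('k) r" by simp
      then show ?thesis
        using rat_to_field_mult(2)[of 2 r, where 'k = 'k] rat_to_field_of_int[of 2, where 'k = 'k] by simp
    qed
    then show ?thesis using l eq True rat_to_field_of_int(2)[of 0, where 'k = 'k]
      by (simp add: lookup_ga_scale lookup_rho0_elt[OF assms(2)] r_def)
  next
    case False
    then show ?thesis using l by (simp add: lookup_ga_scale lookup_rho0_elt[OF assms(2)])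
  qed
qed

theorem theorem6p2:
  fixes n :: nat
  assumes "CHAR('k::field) \<noteq> 2" and "n > 0"
  shows "phi (e_elt n :: (int \<Rightarrow> int) \<Rightarrow>\<^sub>0 'k) = (if even n then rho_elt n else 0)
    \<and> ((\<forall>j\<in>{1..n}. rat_makes_sense TYPE('k) (e0_coeff n j)) \<longrightarrow>
        phi (e0_elt n :: (int \<Rightarrow> int) \<Rightarrow>\<^sub>0 'k) = (if even n then 0 else ga_scale 2 (rho0_elt n)))
    \<and> (even n \<longrightarrow> ga_idempotent (sym_group n) (rho_elt n :: (nat \<Rightarrow> nat) \<Rightarrow>\<^sub>0 'k))
    \<and> (odd n \<longrightarrow> (\<forall>j\<in>{1..(n + 1) div 2}. rat_makes_sense TYPE('k) (rho0_coeff n j)) \<longrightarrow>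
        ga_idempotent (sym_group n) (rho0_elt n :: (nat \<Rightarrow> nat) \<Rightarrow>\<^sub>0 'k))"
proof (intro conjI impI)
  show "phi (e_elt n :: (int \<Rightarrow> int) \<Rightarrow>\<^sub>0 'k) = (if even n then rho_elt n else 0)"
    by (rule phi_e_elt[OF assms(1)])
  show "phi (e0_elt n :: (int \<Rightarrow> int) \<Rightarrow>\<^sub>0 'k) = (if even n then 0 else ga_scale 2 (rho0_elt n))"
    if "\<forall>j\<in>{1..n}. rat_makes_sense TYPE('k) (e0_coeff n j)"
    by (rule phi_e0_elt[OF assms that])
  show "ga_idempotent (sym_group n) (rho_elt n :: (nat \<Rightarrow> nat) \<Rightarrow>\<^sub>0 'k)" if "even n"
  proof (rule ga_idempotent_sym_groupI[OF lookup_rho_elt])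
    fix \<sigma> assume "\<sigma> permutes {1..n}"
    then show "rat_makes_sense TYPE('k) (rho_coeff n (card (Peak n \<sigma>)))"
      using card_Peak_le[of \<sigma> n] by (intro rho_coeff_makes_sense assms that) auto
  qed (rule rho_coeff_idem[OF _ that assms(2)])
  show "ga_idempotent (sym_group n) (rho0_elt n :: (nat \<Rightarrow> nat) \<Rightarrow>\<^sub>0 'k)"
    if "odd n" "\<forall>j\<in>{1..(n + 1) div 2}. rat_makes_sense TYPE('k) (rho0_coeff n j)"
  proof (rule ga_idempotent_sym_groupI[OF lookup_rho0_elt[OF assms(2)]])
    fix \<sigma> assume "\<sigma> permutes {1..n}"
    then have "Suc (card (Peak n \<sigma> - {1})) \<in> {1..(n + 1) div 2}"
      using card_Peak_minus_le[of \<sigma> n] assms(2) by auto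
    then show "rat_makes_sense TYPE('k) (rho0_coeff n (Suc (card (Peak n \<sigma> - {1}))))"
      using that(2) by blast
  qed (rule rho0_coeff_idem[OF _ that(1)])
qed

end
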